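(* Let $n\ge 2$, let $J\subseteq[n-1]$ and $J'=J\cup\{n\}$. Let $U$ be the $\Omega_J\times\Omega_{J'}$ matrix whose $(v,u)$ entry is the number of $\vartheta\in\{+,-\}^n$ with $v=\tau_\vartheta u$. Then \[ U M_{J'} = M_J U. \] Consequently, if $u$ is distributed according to $\pi_{J'}$ and $\vartheta$ is chosen uniformly from $\{+,-\}^n$ independently, then $\tau_\vartheta u$ is distributed according to $\pi_J$.
   Context: Type C TASEP. Fix $n\ge 2$. Sites: upper $U_1,\dots,U_n$, lower $L_1,\dots,L_n$ (column $j$ consists of $U_j,L_j$). Counter-clockwise successor: $\mathrm{succ}(U_j)=U_{j-1}$ ($j\ge2$), $\mathrm{succ}(U_1)=L_1$, $\mathrm{succ}(L_j)=L_{j+1}$ ($j<n$), $\mathrm{succ}(L_n)=U_n$; the clockwise successor is the inverse map ($U_j\mapsto U_{j+1}$ for $j<n$, $U_n\mapsto L_n$, $L_j\mapsto L_{j-1}$ for $j>1$, $L_1\mapsto U_1$). A state places particles with positive integer classes on sites, at most one per column. Bell at site $s$: if $s$ holds particle $p$ and $s'=\mathrm{succ}(s)$ is empty, $p$ moves to $s'$; if $s'$ holds a particle of strictly larger class, they swap; otherwise nothing. $\sigma_0$ = bell at $U_1$; $\sigma_n$ = bell at $L_n$; for $0<j<n$, $\sigma_j$ = bells at $L_j$ and $U_{j+1}$. The chain $\Theta$ has transitions $x\to\sigma_jx$, $j=0,\dots,n$, of rate $1$ for $j\in\{0,n\}$ and $2$ for $0<j<n$. For $J\subseteq[n]$: starting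 from one particle of each class $1,\dots,n$, identify classes $j,j+1$ for each $j\in J\setminus\{n\}$, remove class $n$ if $n\in J$, renumber; the resulting counts form the type $\mathbf m_J$, $\Omega_J$ is the set of states of that type, $\Theta_J$ the restriction of $\Theta$ to $\Omega_J$, with unique stationary distribution $\pi_J$. $M_J$ is the $\Omega_J\times\Omega_J$ matrix whose $(x,y)$ entry is the total rate of transitions of $\Theta_J$ from $y$ to $x$. The map $\tau_\vartheta$: for $u\in\Omega_{J'}$ and $\vartheta\in\{+,-\}^n$, build a state $v$ as follows. The designated sites of $v$ are, for each column $j$, $U_j$ if $\vartheta_j=+$ and $L_j$ if $\vartheta_j=-$; initially all are "not yet occupied". Process the particles of $u$ in an order of nondecreasing class (order among equal classes is irrelevant): for a particle $p$ at site $s$ of $u$, place $p$ (with its class) at the first not-yet-occupied designated site encountered starting at $s$ itself and moving clockwise; that site becomes occupied. After all particles of $u$ are processed, fill the remaining designated sites with particles of a new class one larger than the largest class in $u$. Then $v=\tau_\vartheta u\in\Omega_J$. *)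

theory Defs
  imports Complex_Main "HOL-Library.Product_Lexorder"
begin

text \<open>Sites: (True, j) is the upper site U_j, (False, j) is the lower site L_j.
  A state is a map from sites to particle classes (None = empty site).\<close>

type_synonym site = "bool \<times> nat"
type_synonym state = "site \<Rightarrow> nat option"

text \<open>Counter-clockwise successor.\<close>
fun succ_site :: "nat \<Rightarrow> site \<Rightarrow> site" where
  "succ_site n (True, j) = (if j \<ge> 2 then (True, j - 1) else (False, 1))"
| "succ_site n (False, j) = (if j < n then (False, j + 1) else (True, n))"

fun cw_site :: "nat \<Rightarrow> site \<Rightarrow> site" where
  "cw_site n (True, j) = (if j < n then (True, j + 1) else (False, n))"
| "cw_site n (False, j) = (if j > 1 then (False, j - 1) else (True, 1))"

definition bell :: "nat \<Rightarrow> site \<Rightarrow> state \<Rightarrow> state" where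
  "bell n s x = (case x s of
      None \<Rightarrow> x
    | Some p \<Rightarrow> (case x (succ_site n s) of
         None \<Rightarrow> x(s := None, succ_site n s := Some p)
       | Some q \<Rightarrow> (if p < q then x(s := Some q, succ_site n s := Some p) else x)))"

definition sigma :: "nat \<Rightarrow> nat \<Rightarrow> state \<Rightarrow> state" where
  "sigma n j x = (if j = 0 then bell n (True, 1) x
                  else if j = n then bell n (False, n) x
                  else bell n (True, j + 1) (bell n (False, j) x))"

definition rate :: "nat \<Rightarrow> nat \<Rightarrow> nat" where
  "rate n j = (if j = 0 \<or> j = n then 1 else 2)"

definition wf_state :: "nat \<Rightarrow> state \<Rightarrow> bool" where
  "wf_state n x \<longleftrightarrow>
     (\<forall>s. x s \<noteq> None \<longrightarrow> 1 \<le> snd s \<and> snd s \<le> n) \<and>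
     (\<forall>j. \<not> (x (True, j) \<noteq> None \<and> x (False, j) \<noteq> None))"

text \<open>New class of original class i (1..n) after identifying j, j+1 for j in J, j < n.\<close>
definition new_class :: "nat \<Rightarrow> nat set \<Rightarrow> nat \<Rightarrow> nat" where
  "new_class n J i = 1 + card {j. 1 \<le> j \<and> j < i \<and> j \<notin> J}"

text \<open>The type m_J: number of particles of each class k.  If n is in J, the
  (merged) class containing n is removed.\<close>
definition mtype :: "nat \<Rightarrow> nat set \<Rightarrow> nat \<Rightarrow> nat" where
  "mtype n J k = card {i. 1 \<le> i \<and> i \<le> n \<and> new_class n J i = k \<and>
                         \<not> (n \<in> J \<and> new_class n J i = new_class n J n)}"

definition Omega :: "nat \<Rightarrow> nat set \<Rightarrow> state set" where
  "Omega n J = {x. wf_state n x \<and> (\<forall>k. card {s. x s = Some k} = mtype n J k)}"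

text \<open>M_J: (x,y) entry is the total rate of transitions y \<rightarrow> x of Theta_J
  (self-loops sigma_j y = y included).\<close>
definition Mmat :: "nat \<Rightarrow> nat set \<Rightarrow> state \<Rightarrow> state \<Rightarrow> nat" where
  "Mmat n J x y = (if x \<in> Omega n J \<and> y \<in> Omega n J
      then (\<Sum>j\<in>{0..n}. if sigma n j y = x then rate n j else 0) else 0)"

definition is_stationary :: "nat \<Rightarrow> nat set \<Rightarrow> (state \<Rightarrow> real) \<Rightarrow> bool" where
  "is_stationary n J p \<longleftrightarrow>
     (\<forall>x. x \<notin> Omega n J \<longrightarrow> p x = 0) \<and>
     (\<forall>x\<in>Omega n J. p x \<ge> 0) \<and>
     (\<Sum>x\<in>Omega n J. p x) = 1 \<and>
     (\<forall>x\<in>Omega n J. (\<Sum>y\<in>Omega n J. real (Mmat n J x y) * p y)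
                     = p x * (\<Sum>y\<in>Omega n J. real (Mmat n J y x)))"

text \<open>The (unique) stationary distribution pi_J, extended by 0 outside Omega_J.\<close>
definition pi_stat :: "nat \<Rightarrow> nat set \<Rightarrow> state \<Rightarrow> real" where
  "pi_stat n J = (THE p. is_stationary n J p)"

text \<open>Sign vectors theta in {+,-}^n: bool lists of length n, theta ! (j-1) = True
  meaning theta_j = + (designated site U_j).\<close>
definition signs :: "nat \<Rightarrow> bool list set" where
  "signs n = {th. length th = n}"

definition desig :: "nat \<Rightarrow> bool list \<Rightarrow> site \<Rightarrow> bool" where
  "desig n th s \<longleftrightarrow> 1 \<le> snd s \<and> snd s \<le> n \<and> th ! (snd s - 1) = fst s"

definition place :: "nat \<Rightarrow> bool list \<Rightarrow> nat \<times> site \<Rightarrow> state \<Rightarrow> state" where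
  "place n th cs v = (let c = fst cs; s = snd cs;
      k = (LEAST k. desig n th ((cw_site n ^^ k) s) \<and> v ((cw_site n ^^ k) s) = None)
    in v((cw_site n ^^ k) s := Some c))"

definition tau :: "nat \<Rightarrow> bool list \<Rightarrow> state \<Rightarrow> state" where
  "tau n th u = (let ps = sorted_list_of_set {(c, s). u s = Some c};
      v = fold (place n th) ps (\<lambda>_. None);
      m = Max (insert 0 (ran u))
    in (\<lambda>s. if desig n th s \<and> v s = None then Some (m + 1) else v s))"

definition Umat :: "nat \<Rightarrow> state \<Rightarrow> state \<Rightarrow> nat" where
  "Umat n v u = card {th \<in> signs n. tau n th u = v}"

end

theory Submission
  imports Defs
begin

text \<open>The sites form a ring of length \<open>2n\<close>, and \<open>\<tau>\<^sub>\<theta>\<close> is a queue on this ring: the particles of class at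
  most \<open>c\<close> arrive at a set \<open>S\<close> of sites, walk clockwise and park on the designated sites \<open>D\<close>. The set of
  sites parked on does not depend on the order of arrival, and bells commute with truncation at \<open>c\<close>,
  so everything reduces to one class and one bell from \<open>i\<close> to \<open>t = succ i\<close>. Ringing this bell on
  arrivals and designated sites alike rings it on the parked set, unless \<open>i \<notin> D\<close> and \<open>t \<in> D\<close>;
  it leaves the parked set alone if \<open>i \<notin> D\<close>, and is not felt through the arrivals if \<open>t \<notin> D\<close>.

  Call \<open>\<sigma>\<^sub>j\<close> active for \<open>\<theta>\<close> if it moves designated sites, and spent if it would do so after reversal. Then
  \<open>\<sigma>\<^sub>j \<tau>\<^sub>\<theta> u\<close> is \<open>\<tau>\<^sub>\<theta>\<^sub>' \<sigma>\<^sub>j u\<close> with \<open>\<theta>'\<close> the flipped sign vector if active, \<open>\<tau>\<^sub>\<theta> u\<close> if spent, and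
  \<open>\<tau>\<^sub>\<theta> \<sigma>\<^sub>j u\<close> otherwise, while \<open>\<tau>\<^sub>\<theta> \<sigma>\<^sub>j u = \<tau>\<^sub>\<theta> u\<close> if active. The total rates of active and of
  spent \<open>j\<close> agree for each \<open>\<theta>\<close>, being the numbers of descents and ascents around the ring.\<close>

section \<open>Parking on a ring\<close>

text \<open>A relation instead of a function, because a walk along \<open>f\<close> may miss
  \<open>A\<close> for ever. Walks are then handled by rule induction, without step counts.\<close>

inductive hit :: "('a \<Rightarrow> 'a) \<Rightarrow> 'a set \<Rightarrow> 'a \<Rightarrow> 'a \<Rightarrow> bool" for f A where
  here: "x \<in> A \<Longrightarrow> hit f A x x"
| step: "x \<notin> A \<Longrightarrow> hit f A (f x) y \<Longrightarrow> hit f A x y"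

lemma hit_mem: "hit f A x y \<Longrightarrow> y \<in> A"
  by (induction rule: hit.induct)

lemma hit_unique: "hit f A x y \<Longrightarrow> hit f A x z \<Longrightarrow> y = z"
proof (induction rule: hit.induct)
  case (here x)
  then show ?case by (auto elim: hit.cases)
next
  case (step x y)
  from step.prems step.hyps(1) have "hit f A (f x) z" by (auto elim: hit.cases)
  then show ?case by (rule step.IH)
qed

lemma hit_here_iff: "x \<in> A \<Longrightarrow> hit f A x y \<longleftrightarrow> y = x"
  by (auto intro: hit.here elim: hit.cases)

lemma hit_step_iff: "x \<notin> A \<Longrightarrow> hit f A x y \<longleftrightarrow> hit f A (f x) y"
  by (auto intro: hit.step elim: hit.cases)

lemma hit_subset: "hit f A x y \<Longrightarrow> B \<subseteq> A \<Longrightarrow> y \<in> B \<Longrightarrow> hit f B x y"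
  by (induction rule: hit.induct) (auto intro: hit.intros)

text \<open>Link to the \<open>LEAST\<close> step count in \<open>place\<close>: as long as the walk
  is outside \<open>A\<close>, the least count drops by one with each step.\<close>

lemma hit_Least:
  assumes "(f ^^ k) x \<in> A"
  shows "hit f A x ((f ^^ (LEAST k. (f ^^ k) x \<in> A)) x)"
  using assms
proof (induction k arbitrary: x)
  case 0
  then have "(LEAST k. (f ^^ k) x \<in> A) = 0" by (intro Least_equality) auto
  with 0 show ?case by (auto intro: hit.here)
next
  case (Suc k)
  show ?case
  proof (cases "x \<in> A")
    case True
    then have "(LEAST k. (f ^^ k) x \<in> A) = 0" by (intro Least_equality) auto
    with True show ?thesis by (auto intro: hit.here)
  next
    case False
    have eq: "(f ^^ Suc m) x = (f ^^ m) (f x)" for m by (simp add: funpow_swap1)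
    have "(LEAST k. (f ^^ k) x \<in> A) = Suc (LEAST m. (f ^^ Suc m) x \<in> A)"
      by (rule Least_Suc[where P = "\<lambda>k. (f ^^ k) x \<in> A", OF Suc.prems]) (use False in simp)
    then have "(f ^^ (LEAST k. (f ^^ k) x \<in> A)) x = (f ^^ (LEAST m. (f ^^ m) (f x) \<in> A)) (f x)"
      by (simp only: eq)
    moreover have "hit f A (f x) ((f ^^ (LEAST m. (f ^^ m) (f x) \<in> A)) (f x))"
      by (rule Suc.IH) (use Suc.prems in \<open>simp add: funpow_swap1\<close>)
    ultimately show ?thesis using False by (simp add: hit_step_iff)
  qed
qed

text \<open>The sites still free after a walker from \<open>x\<close> has parked. A walker that
  finds no site changes nothing, so the operation is total and can be folded.\<close>

definition take_first :: "('a \<Rightarrow> 'a) \<Rightarrow> 'a \<Rightarrow> 'a set \<Rightarrow> 'a set" where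
  "take_first f x A = A - {y. hit f A x y}"

lemma take_first_hit: "hit f A x y \<Longrightarrow> take_first f x A = A - {y}"
  by (auto simp: take_first_def dest: hit_unique)

lemma take_first_no_hit: "(\<And>y. \<not> hit f A x y) \<Longrightarrow> take_first f x A = A"
  by (auto simp: take_first_def)

lemma take_first_here: "x \<in> A \<Longrightarrow> take_first f x A = A - {x}"
  by (simp add: take_first_def hit_here_iff)

lemma take_first_step: "x \<notin> A \<Longrightarrow> take_first f x A = take_first f (f x) A"
  by (simp add: take_first_def hit_step_iff)

lemma take_first_subset: "take_first f x A \<subseteq> A"
  by (auto simp: take_first_def)

text \<open>Before reaching \<open>y\<close> the walker meets no element of \<open>A\<close>, hence
  none of \<open>B\<close>, and so may as well start at \<open>y\<close>.\<close>

lemma take_first_from_hit: "hit f A x y \<Longrightarrow> B \<subseteq> A \<Longrightarrow> take_first f x B = take_first f y B"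
proof (induction rule: hit.induct)
  case (step x y)
  then have "x \<notin> B" by auto
  with step show ?case by (simp add: take_first_step)
qed simp

lemma no_hit_subset:
  assumes "\<And>y. \<not> hit f A x y" "B \<subseteq> A" shows "\<not> hit f B x y"
proof
  assume "hit f B x y"
  then have "\<exists>z. hit f A x z" using assms(2)
  proof (induction rule: hit.induct)
    case (step x y)
    then show ?case by (cases "x \<in> A") (auto intro: hit.intros)
  qed (auto intro: hit.here)
  with assms(1) show False by blast
qed

text \<open>If two walkers would stop at the same place, the one arriving second goes on from there,
  so only the set of places taken matters.\<close>
lemma take_first_commute:
  "take_first f x (take_first f y A) = take_first f y (take_first f x A)"
proof -
  consider (x) "\<And>z. \<not> hit f A x z" | (y) "\<And>z. \<not> hit f A y z"
    | (xy) a b where "hit f A x a" "hit f A y b" by blast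
  then show ?thesis
  proof cases
    case x
    then show ?thesis
      by (metis take_first_no_hit no_hit_subset take_first_subset)
  next
    case y
    then show ?thesis
      by (metis take_first_no_hit no_hit_subset take_first_subset)
  next
    case xy
    show ?thesis
    proof (cases "a = b")
      case True
      then show ?thesis using xy
        by (metis take_first_from_hit take_first_hit Diff_subset)
    next
      case False
      have "hit f (A - {b}) x a"
        by (rule hit_subset[OF xy(1)]) (use False hit_mem[OF xy(1)] in auto)
      moreover have "hit f (A - {a}) y b"
        by (rule hit_subset[OF xy(2)]) (use False hit_mem[OF xy(2)] in auto)
      ultimately show ?thesis using xy by (auto simp: take_first_hit)
    qed
  qed
qed

text \<open>Commutation makes the fold in \<open>vacant\<close> independent of the order of
  arrival.\<close>

interpretation take_first: comp_fun_commute "take_first f"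
  by standard (auto simp: fun_eq_iff take_first_commute)

definition vacant :: "('a \<Rightarrow> 'a) \<Rightarrow> 'a set \<Rightarrow> 'a set \<Rightarrow> 'a set" where
  "vacant f D S = Finite_Set.fold (take_first f) D S"

definition park :: "('a \<Rightarrow> 'a) \<Rightarrow> 'a set \<Rightarrow> 'a set \<Rightarrow> 'a set" where
  "park f D S = D - vacant f D S"

text \<open>A bell at \<open>i\<close> with successor \<open>t\<close>, seen only through a set of
  sites; it acts on arrivals, designated sites and parked sites alike.\<close>

definition hop :: "'a \<Rightarrow> 'a \<Rightarrow> 'a set \<Rightarrow> 'a set" where
  "hop i t X = (if i \<in> X \<and> t \<notin> X then insert t (X - {i}) else X)"

lemma vacant_empty [simp]: "vacant f D {} = D"
  by (simp add: vacant_def)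

lemma vacant_insert: "finite S \<Longrightarrow> x \<notin> S \<Longrightarrow> vacant f D (insert x S) = take_first f x (vacant f D S)"
  by (simp add: vacant_def)

lemma vacant_subset: "vacant f D S \<subseteq> D"
proof (cases "finite S")
  case True
  then show ?thesis
    by (induction S) (auto simp: vacant_insert dest: subsetD[OF take_first_subset])
qed (simp add: vacant_def)

lemma card_hop:
  assumes "finite X" shows "card (hop i t X) = card X"
proof (cases "i \<in> X \<and> t \<notin> X")
  case True
  then have "card (insert t (X - {i})) = card X"
    using assms card_Suc_Diff1[of X i] by (simp add: card_insert_disjoint del: card_Diff_insert)
  then show ?thesis using True by (simp add: hop_def)
qed (auto simp: hop_def)

section \<open>Parking on a cyclic ground set, and the effect of one bell\<close>

locale cyclic_step =
  fixes f :: "'a \<Rightarrow> 'a" and R :: "'a set"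
  assumes closed: "x \<in> R \<Longrightarrow> f x \<in> R"
    and fin: "finite R"
    and cyclic: "x \<in> R \<Longrightarrow> y \<in> R \<Longrightarrow> \<exists>k. (f ^^ k) x = y"
begin

lemma hit_exists:
  assumes "x \<in> R" "y \<in> A" "y \<in> R"
  obtains z where "hit f A x z"
proof -
  obtain k where "(f ^^ k) x = y" using cyclic assms by blast
  with assms(2) have "(f ^^ k) x \<in> A" by simp
  from that[OF hit_Least[OF this]] show thesis .
qed

text \<open>While a site is free, cyclicity leads every arrival to one. Truncated subtraction covers
  arrivals in excess of the supply.\<close>

lemma card_vacant:
  assumes "S \<subseteq> R" "D \<subseteq> R"
  shows "card (vacant f D S) = card D - card S"
proof -
  have "finite S" using assms fin finite_subset by blast
  then show ?thesis using assms(1)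
  proof (induction S)
    case (insert x S)
    have fv: "finite (vacant f D S)"
      using vacant_subset assms fin by (metis finite_subset)
    show ?case
    proof (cases "vacant f D S = {}")
      case True
      then have "take_first f x (vacant f D S) = {}" by (simp add: take_first_def)
      with True insert show ?thesis by (simp add: vacant_insert)
    next
      case False
      then obtain y where "y \<in> vacant f D S" by auto
      moreover from this have "y \<in> R" using vacant_subset[of f D S] assms(2) by auto
      ultimately obtain z where z: "hit f (vacant f D S) x z"
        using hit_exists[of x y "vacant f D S"] insert.prems by auto
      with fv insert show ?thesis
        by (simp add: vacant_insert take_first_hit card_Diff_singleton hit_mem)
    qed
  qed simp
qed

lemma card_park:
  assumes "S \<subseteq> R" "D \<subseteq> R" "card S \<le> card D"
  shows "card (park f D S) = card S"
proof -
  have "finite D" using assms fin finite_subset by blast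
  then have "card (park f D S) = card D - card (vacant f D S)"
    unfolding park_def
    using card_Diff_subset[of "vacant f D S" D] vacant_subset[of f D S] finite_subset by blast
  with assms show ?thesis by (simp add: card_vacant)
qed

end

text \<open>Walkers follow \<open>f\<close>, whereas the bell moves a particle against
  \<open>f\<close>, from \<open>i\<close> to \<open>t\<close>. By \<open>only_t\<close>, whoever
  enters \<open>i\<close> comes from \<open>t\<close>.\<close>

locale cyclic_pair = cyclic_step f R for f :: "'a \<Rightarrow> 'a" and R +
  fixes i t :: 'a
  assumes t_in: "t \<in> R" and ft: "f t = i" and it: "i \<noteq> t"
    and only_t: "y \<in> R \<Longrightarrow> f y = i \<Longrightarrow> y = t"
begin

lemma i_in: "i \<in> R" using closed[OF t_in] ft by simp

lemma hop_subset: "X \<subseteq> R \<Longrightarrow> hop i t X \<subseteq> R"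
  using t_in by (auto simp: hop_def)

text \<open>Splitting off \<open>i\<close> exhibits the set before and after a genuine hop as one
  insertion into a common \<open>T\<close>, ready for \<open>vacant_insert\<close>.\<close>

lemma hop_cases [consumes 1, case_names stay move]:
  assumes "S \<subseteq> R"
    and "hop i t S = S \<Longrightarrow> P"
    and "\<And>T. S = insert i T \<Longrightarrow> i \<notin> T \<Longrightarrow> t \<notin> T \<Longrightarrow> finite T \<Longrightarrow> T \<subseteq> R
           \<Longrightarrow> hop i t S = insert t T \<Longrightarrow> P"
  shows P
proof (cases "i \<in> S \<and> t \<notin> S")
  case True
  show ?thesis
    by (rule assms(3)[of "S - {i}"])
      (use True assms(1) fin in \<open>auto simp: hop_def intro: finite_subset\<close>)
next
  case False
  then show ?thesis using assms(2) by (auto simp: hop_def)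
qed

text \<open>A walker put on the undesignated site \<open>t\<close> steps straight back to
  \<open>i\<close>.\<close>

lemma vacant_hop_idle:
  assumes "t \<notin> D" "S \<subseteq> R"
  shows "vacant f D (hop i t S) = vacant f D S"
  using assms(2)
proof (cases rule: hop_cases)
  case (move T)
  have "t \<notin> vacant f D T" using assms(1) vacant_subset by fast
  with move show ?thesis by (simp add: vacant_insert take_first_step[of t] ft)
qed simp

lemma hit_i_passes_t:
  "hit f A x y \<Longrightarrow> y = i \<Longrightarrow> x \<in> R \<Longrightarrow> x \<noteq> i \<Longrightarrow> t \<notin> A"
proof (induction rule: hit.induct)
  case (step x y)
  show ?case
  proof (cases "f x = i")
    case True
    then show ?thesis using only_t step by auto
  next
    case False
    then show ?thesis using step closed by auto
  qed
qed simp

text \<open>With no arrival at \<open>i\<close>, whoever takes \<open>i\<close> has passed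
  \<open>t\<close>; so \<open>i\<close> cannot be used up while \<open>t\<close> is free.\<close>

lemma vacant_t_imp_i:
  assumes "S \<subseteq> R" "i \<notin> S" "i \<in> D"
  shows "t \<in> vacant f D S \<Longrightarrow> i \<in> vacant f D S"
proof -
  have "finite S" using assms fin finite_subset by blast
  then show "t \<in> vacant f D S \<Longrightarrow> i \<in> vacant f D S" using assms(1,2)
  proof (induction S)
    case (insert x S)
    then have t: "t \<in> take_first f x (vacant f D S)" by (simp add: vacant_insert)
    then have "t \<in> vacant f D S" using take_first_subset by fast
    moreover from this have "i \<in> vacant f D S" using insert by auto
    moreover have "\<not> hit f (vacant f D S) x i"
      using hit_i_passes_t calculation insert.prems by blast
    ultimately show ?case using insert by (simp add: vacant_insert take_first_def)
  qed (use assms in simp)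
qed

text \<open>Moving the free site \<open>i\<close> to \<open>t\<close> lets a walker bound for
  \<open>i\<close> stop one step earlier and leaves all others alone. A walker starting at
  \<open>i\<close> would lose its site instead, which \<open>x \<noteq> i\<close> excludes.\<close>

lemma take_first_hop:
  assumes "t \<notin> A" "x \<in> R" "x \<noteq> i"
  shows "take_first f x (hop i t A) = hop i t (take_first f x A)"
proof (cases "i \<in> A")
  case False
  then have "i \<notin> take_first f x A" using take_first_subset by fast
  with False show ?thesis by (simp add: hop_def)
next
  case True
  have hit_hop: "hit f (hop i t A) x (if y = i then t else y)" if "hit f A x y" "x \<in> R" "x \<noteq> i" for x y
    using that
  proof (induction rule: hit.induct)
    case (here x)
    then show ?case using assms(1) True by (auto simp: hop_def intro: hit.here)
  next
    case (step x y)
    show ?case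
    proof (cases "x = t")
      case x: True
      then have "y = i" using step True by (simp add: ft hit_here_iff)
      then show ?thesis using x True assms(1) by (auto simp: hop_def intro: hit.here)
    next
      case False
      then have "f x \<noteq> i" using only_t step.prems by blast
      then have "hit f (hop i t A) (f x) (if y = i then t else y)"
        using step closed by blast
      moreover have "x \<notin> hop i t A" using step False by (auto simp: hop_def)
      ultimately show ?thesis by (auto intro: hit.step)
    qed
  qed
  obtain y where y: "hit f A x y" using hit_exists assms(2) True i_in by blast
  have "y \<in> A" using y hit_mem by fast
  with y hit_hop[OF y assms(2,3)] True assms(1) it show ?thesis
    by (auto simp: take_first_hit hop_def)
qed

lemma vacant_hop_unserved:
  assumes "t \<notin> D" "i \<notin> S" "S \<subseteq> R"
  shows "vacant f (hop i t D) S = hop i t (vacant f D S)"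
proof -
  have "finite S" using assms fin finite_subset by blast
  then show ?thesis using assms(2,3)
  proof (induction S)
    case (insert x S)
    have "t \<notin> vacant f D S" using assms(1) vacant_subset by fast
    moreover have "x \<in> R" "x \<noteq> i" using insert.prems by auto
    ultimately show ?case using insert by (simp add: vacant_insert take_first_hop)
  qed simp
qed

lemma vacant_hop_hop:
  assumes "t \<notin> D" "S \<subseteq> R"
  shows "vacant f (hop i t D) (hop i t S) = hop i t (vacant f D S)"
proof (cases "i \<in> S")
  case False
  then have "hop i t S = S" by (simp add: hop_def)
  with vacant_hop_unserved assms False show ?thesis by simp
next
  case True
  \<comment> \<open>The arrival at \<open>i\<close> is the one that \<open>take_first_hop\<close>
    excludes; by commutation it can be made the last.\<close>
  define T where "T = S - {i}"
  have T: "S = insert i T" "i \<notin> T" "finite T" "T \<subseteq> R"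
    using True assms fin by (auto simp: T_def intro: finite_subset)
  have tv: "t \<notin> vacant f D T" using assms(1) vacant_subset by fast
  have vT: "vacant f (hop i t D) T = hop i t (vacant f D T)"
    using vacant_hop_unserved assms T by blast
  show ?thesis
  proof (cases "t \<in> S")
    case False
    then have hS: "hop i t S = insert t T" "t \<notin> T" using T by (auto simp: hop_def)
    have "vacant f (hop i t D) (hop i t S) = take_first f t (hop i t (vacant f D T))"
      using hS T vT by (simp add: vacant_insert)
    also have "\<dots> = hop i t (take_first f t (vacant f D T))"
      using take_first_hop tv t_in it by blast
    also have "\<dots> = hop i t (vacant f D S)"
      using T tv by (simp add: vacant_insert take_first_step ft)
    finally show ?thesis .
  next
    case t: True
    define T' where "T' = T - {t}"
    have T': "T = insert t T'" "t \<notin> T'" "finite T'"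
      using t T it by (auto simp: T'_def)
    \<comment> \<open>The walker from \<open>t\<close> goes on to \<open>i\<close> and takes it if
      it is free, so afterwards the hop has no vacant \<open>i\<close> to move.\<close>
    have "t \<notin> vacant f D T'" using assms(1) vacant_subset by fast
    then have "vacant f D T = take_first f i (vacant f D T')"
      using T' by (simp add: vacant_insert take_first_step ft)
    then have iv: "i \<notin> vacant f D T" by (auto simp: take_first_def hit_here_iff)
    have "hop i t S = S" using t by (simp add: hop_def)
    moreover have "hop i t (vacant f D T) = vacant f D T" using iv by (simp add: hop_def)
    moreover have "i \<notin> take_first f i (vacant f D T)" using iv take_first_subset by fast
    then have "hop i t (take_first f i (vacant f D T)) = take_first f i (vacant f D T)"
      by (simp add: hop_def)
    ultimately show ?thesis using T vT by (simp add: vacant_insert)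
  qed
qed

lemma park_hop_idle:
  assumes "t \<notin> D" "S \<subseteq> R"
  shows "park f D (hop i t S) = park f D S"
  using vacant_hop_idle[OF assms] by (simp add: park_def)

lemma hop_park_idle: "i \<notin> D \<Longrightarrow> hop i t (park f D S) = park f D S"
  by (simp add: hop_def park_def)

text \<open>If the bell moves an arrival, the two walks differ only when \<open>t\<close> is free;
  then \<open>i\<close> is free as well, and the parked particle moves with its arrival. If it moves
  none, a parked \<open>i\<close> forces a parked \<open>t\<close>.\<close>

lemma park_hop_hop_both:
  assumes "i \<in> D" "t \<in> D" "S \<subseteq> R"
  shows "park f D (hop i t S) = hop i t (park f D S)"
  using assms(3)
proof (cases rule: hop_cases)
  case stay
  have "t \<notin> vacant f D S" if "i \<in> S"
  proof -
    have "t \<in> S" using stay that it by (auto simp: hop_def split: if_splits)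
    define T where "T = S - {t}"
    have T: "S = insert t T" "t \<notin> T" "finite T" "T \<subseteq> R"
      using \<open>t \<in> S\<close> assms fin by (auto simp: T_def intro: finite_subset)
    then have "vacant f D S = take_first f t (vacant f D T)" by (simp add: vacant_insert)
    then show ?thesis by (auto simp: take_first_def hit_here_iff)
  qed
  moreover have "i \<in> vacant f D S" if "t \<in> vacant f D S" "i \<notin> S"
    using vacant_t_imp_i assms that by blast
  ultimately show ?thesis using stay assms by (auto simp: hop_def park_def)
next
  case (move T)
  let ?V = "vacant f D T"
  have tv: "t \<in> ?V \<Longrightarrow> i \<in> ?V" using vacant_t_imp_i move assms by blast
  have S: "park f D S = D - take_first f i ?V" using move by (simp add: park_def vacant_insert)
  have hS: "park f D (hop i t S) = D - take_first f t ?V"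
    using move by (simp add: park_def vacant_insert)
  show ?thesis
  proof (cases "t \<in> ?V")
    case True
    then have "take_first f t ?V = ?V - {t}" "take_first f i ?V = ?V - {i}"
      using tv by (simp_all add: take_first_here)
    then show ?thesis using S hS True tv assms it by (auto simp: hop_def)
  next
    case False
    then have "take_first f t ?V = take_first f i ?V" by (simp add: take_first_step ft)
    moreover have "t \<notin> take_first f i ?V" using False take_first_subset by fast
    ultimately show ?thesis using S hS assms by (simp add: hop_def)
  qed
qed

lemma park_hop_hop:
  assumes "\<not> (i \<notin> D \<and> t \<in> D)" "S \<subseteq> R"
  shows "park f (hop i t D) (hop i t S) = hop i t (park f D S)"
proof (cases "t \<in> D")
  case True
  then have "hop i t D = D" by (simp add: hop_def)
  with True park_hop_hop_both assms show ?thesis by simp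
next
  case False
  have "vacant f D S \<subseteq> D" by (rule vacant_subset)
  then have "hop i t D - hop i t (vacant f D S) = hop i t (D - vacant f D S)"
    using False it by (auto simp: hop_def)
  then show ?thesis using vacant_hop_hop[OF False assms(2)] by (simp add: park_def)
qed

end

section \<open>States and their truncations\<close>

definition sites :: "nat \<Rightarrow> site set" where
  "sites n = UNIV \<times> {1..n}"

lemma in_sites [simp]: "(b, j) \<in> sites n \<longleftrightarrow> 1 \<le> j \<and> j \<le> n"
  by (auto simp: sites_def)

lemma finite_sites [simp]: "finite (sites n)"
  by (simp add: sites_def)

lemma site_cases:
  obtains j where "s = (True, j)" | j where "s = (False, j)"
  by (metis (full_types) surj_pair)

lemma cw_site_closed: "s \<in> sites n \<Longrightarrow> cw_site n s \<in> sites n"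
  by (cases s rule: site_cases) auto

lemma succ_site_closed: "s \<in> sites n \<Longrightarrow> succ_site n s \<in> sites n"
  by (cases s rule: site_cases) auto

lemma cw_succ_site: "s \<in> sites n \<Longrightarrow> cw_site n (succ_site n s) = s"
  by (cases s rule: site_cases) auto

lemma succ_cw_site: "s \<in> sites n \<Longrightarrow> succ_site n (cw_site n s) = s"
  by (cases s rule: site_cases) auto

lemma succ_site_neq: "s \<in> sites n \<Longrightarrow> succ_site n s \<noteq> s"
  by (cases s rule: site_cases) auto

text \<open>Counter-clockwise enumeration of the sites from \<open>U_n\<close> to \<open>L_n\<close>.\<close>
definition site_at :: "nat \<Rightarrow> nat \<Rightarrow> site" where
  "site_at n p = (if p < n then (True, n - p) else (False, p + 1 - n))"

definition pos :: "nat \<Rightarrow> site \<Rightarrow> nat" where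
  "pos n s = (if fst s then n - snd s else n + snd s - 1)"

lemma site_at_pos: "s \<in> sites n \<Longrightarrow> site_at n (pos n s) = s"
  by (cases s rule: site_cases) (auto simp: site_at_def pos_def)

lemma pos_less: "s \<in> sites n \<Longrightarrow> pos n s < 2 * n"
  by (cases s rule: site_cases) (auto simp: pos_def)

lemma succ_site_at: "Suc p < 2 * n \<Longrightarrow> succ_site n (site_at n p) = site_at n (Suc p)"
  by (auto simp: site_at_def)

lemma cw_site_at: "Suc p < 2 * n \<Longrightarrow> cw_site n (site_at n (Suc p)) = site_at n p"
  by (auto simp: site_at_def)

lemma cw_site_at_0: "n > 0 \<Longrightarrow> cw_site n (site_at n 0) = site_at n (2 * n - 1)"
  by (auto simp: site_at_def)

lemma cw_site_funpow: "p + m < 2 * n \<Longrightarrow> (cw_site n ^^ m) (site_at n (p + m)) = site_at n p"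
proof (induction m)
  case (Suc m)
  then show ?case by (simp add: funpow_swap1 cw_site_at)
qed simp

text \<open>A clockwise step lowers the position by one: walk from \<open>s\<close> down to position
  0, wrap round to position \<open>2 * n - 1\<close>, and walk down to \<open>s'\<close>.\<close>

lemma cyclic_step_cw_site: "cyclic_step (cw_site n) (sites n)"
proof
  fix s s' assume s: "s \<in> sites n" and s': "s' \<in> sites n"
  define p q where "p = pos n s" and "q = pos n s'"
  have pq: "p < 2 * n" "q < 2 * n" using pos_less[OF s] pos_less[OF s'] by (simp_all add: p_def q_def)
  then have n: "n > 0" by linarith
  have "(cw_site n ^^ (2 * n - 1 - q)) (cw_site n ((cw_site n ^^ p) s))
      = (cw_site n ^^ (2 * n - 1 - q)) (site_at n (q + (2 * n - 1 - q)))"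
    using cw_site_funpow[of 0 p n] pq s n cw_site_at_0 by (simp add: p_def site_at_pos)
  also have "\<dots> = s'"
    using cw_site_funpow[of q "2 * n - 1 - q" n] pq s' by (simp add: q_def site_at_pos)
  finally have "(cw_site n ^^ (2 * n - 1 - q + Suc p)) s = s'"
    by (simp add: funpow_add del: add_Suc_right)
  then show "\<exists>k. (cw_site n ^^ k) s = s'" by blast
qed (auto simp: cw_site_closed)

interpretation ring: cyclic_step "cw_site n" "sites n" for n
  by (rule cyclic_step_cw_site)

lemma cyclic_pair_cw_site:
  assumes "s \<in> sites n" shows "cyclic_pair (cw_site n) (sites n) s (succ_site n s)"
proof
  fix y assume "y \<in> sites n" "cw_site n y = s"
  then show "y = succ_site n s" using succ_cw_site by metis
next
  show "succ_site n s \<in> sites n" "cw_site n (succ_site n s) = s"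
    using assms by (simp_all only: succ_site_closed cw_succ_site)
  show "s \<noteq> succ_site n s" using succ_site_neq[OF assms] by metis
qed

section \<open>Truncations of states under bells\<close>

definition below :: "nat \<Rightarrow> state \<Rightarrow> site set" where
  "below c x = {s. \<exists>p. x s = Some p \<and> p \<le> c}"

lemma below_subset_dom: "below c x \<subseteq> dom x"
  by (auto simp: below_def)

text \<open>The class of a particle is the least \<open>c\<close> for which its site lies in
  \<open>below c\<close>, so states may be compared one occupied set at a time.\<close>

lemma state_eqI:
  assumes "\<And>c. below c x = below c y"
  shows "x = y"
proof
  fix s
  have iff: "(\<exists>p. x s = Some p \<and> p \<le> c) \<longleftrightarrow> (\<exists>p. y s = Some p \<and> p \<le> c)" for c
    using assms[of c] by (auto simp: below_def)
  show "x s = y s"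
  proof (cases "x s")
    case None
    then show ?thesis using iff[of "the (y s)"] by (cases "y s") auto
  next
    case (Some p)
    then show ?thesis using iff[of p] iff[of "the (y s)"] by (cases "y s") auto
  qed
qed

abbreviation bell_set :: "nat \<Rightarrow> site \<Rightarrow> site set \<Rightarrow> site set" where
  "bell_set n s \<equiv> hop s (succ_site n s)"

lemma finite_hop: "finite X \<Longrightarrow> finite (hop i t X)"
  by (simp add: hop_def)

definition sigma_set :: "nat \<Rightarrow> nat \<Rightarrow> site set \<Rightarrow> site set" where
  "sigma_set n j X = (if j = 0 then bell_set n (True, 1) X
                  else if j = n then bell_set n (False, n) X
                  else bell_set n (True, j + 1) (bell_set n (False, j) X))"

text \<open>At level \<open>c\<close> a class above \<open>c\<close> looks like an empty site, so
  that moves and swaps alike become a hop or are invisible.\<close>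

lemma below_bell:
  assumes "s \<in> sites n"
  shows "below c (bell n s x) = bell_set n s (below c x)"
  using succ_site_neq[OF assms]
  by (auto simp: below_def bell_def hop_def split: option.splits if_splits)

lemma dom_bell:
  assumes "s \<in> sites n"
  shows "dom (bell n s x) = bell_set n s (dom x)"
  using succ_site_neq[OF assms]
  by (auto simp: bell_def hop_def split: option.splits if_splits)

lemma below_sigma: "1 \<le> n \<Longrightarrow> j \<le> n \<Longrightarrow> below c (sigma n j x) = sigma_set n j (below c x)"
  by (simp add: sigma_def sigma_set_def below_bell)

lemma dom_sigma: "1 \<le> n \<Longrightarrow> j \<le> n \<Longrightarrow> dom (sigma n j x) = sigma_set n j (dom x)"
  by (simp add: sigma_def sigma_set_def dom_bell)

lemma sigma_set_subset: "1 \<le> n \<Longrightarrow> j \<le> n \<Longrightarrow> X \<subseteq> sites n \<Longrightarrow> sigma_set n j X \<subseteq> sites n"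
  by (simp add: sigma_set_def cyclic_pair.hop_subset[OF cyclic_pair_cw_site] del: succ_site.simps)

lemma card_sigma_set: "finite X \<Longrightarrow> card (sigma_set n j X) = card X"
  by (simp add: sigma_set_def card_hop finite_hop)

section \<open>Sign vectors and designated sites\<close>

definition dsites :: "nat \<Rightarrow> bool list \<Rightarrow> site set" where
  "dsites n th = {s. desig n th s}"

lemma in_dsites [simp]: "(b, j) \<in> dsites n th \<longleftrightarrow> 1 \<le> j \<and> j \<le> n \<and> th ! (j - 1) = b"
  by (auto simp: dsites_def desig_def)

lemma dsites_subset: "dsites n th \<subseteq> sites n"
  by auto

lemma card_dsites: "card (dsites n th) = n"
proof -
  have "dsites n th = (\<lambda>j. (th ! (j - 1), j)) ` {1..n}" by (auto simp: image_iff)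
  then show ?thesis by (simp add: card_image inj_on_def)
qed

definition active :: "nat \<Rightarrow> nat \<Rightarrow> bool list \<Rightarrow> bool" where
  "active n j th \<longleftrightarrow> (if j = 0 then th ! 0 else if j = n then \<not> th ! (n - 1)
     else th ! j \<and> \<not> th ! (j - 1))"

definition spent :: "nat \<Rightarrow> nat \<Rightarrow> bool list \<Rightarrow> bool" where
  "spent n j th \<longleftrightarrow> (if j = 0 then \<not> th ! 0 else if j = n then th ! (n - 1)
     else \<not> th ! j \<and> th ! (j - 1))"

text \<open>List index \<open>j - 1\<close> holds the sign of column \<open>j\<close>. Being defined
  for every sign vector, \<open>flip\<close> is an involution that exchanges active and spent
  ones.\<close>

definition flip :: "nat \<Rightarrow> nat \<Rightarrow> bool list \<Rightarrow> bool list" where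
  "flip n j th = (if j = 0 then th[0 := \<not> th ! 0] else if j = n then th[n - 1 := \<not> th ! (n - 1)]
     else th[j - 1 := th ! j, j := th ! (j - 1)])"

lemma flip_in_signs: "th \<in> signs n \<Longrightarrow> flip n j th \<in> signs n"
  by (auto simp: flip_def signs_def)

lemma flip_flip:
  assumes "th \<in> signs n" "1 \<le> n" "j \<le> n"
  shows "flip n j (flip n j th) = th"
  using assms by (intro nth_equalityI) (auto simp: flip_def signs_def nth_list_update split: if_splits)

lemma spent_flip: "th \<in> signs n \<Longrightarrow> 1 \<le> n \<Longrightarrow> j \<le> n \<Longrightarrow> spent n j (flip n j th) \<longleftrightarrow> active n j th"
  by (auto simp: flip_def signs_def spent_def active_def nth_list_update)

text \<open>For inner \<open>j\<close>, activity means that \<open>L_j\<close> and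
  \<open>U_{j+1}\<close> are designated while \<open>L_{j+1}\<close> and \<open>U_j\<close> are not;
  both bells move, and the two columns exchange signs.\<close>

lemma dsites_flip:
  assumes "th \<in> signs n" "1 \<le> n" "j \<le> n" "active n j th"
  shows "dsites n (flip n j th) = sigma_set n j (dsites n th)"
proof -
  have "(b, k) \<in> dsites n (flip n j th) \<longleftrightarrow> (b, k) \<in> sigma_set n j (dsites n th)" for b k
  proof -
    have len: "length th = n" using assms by (simp add: signs_def)
    consider "j = 0" | "j = n" "j \<noteq> 0" | "0 < j" "j < n" using assms by linarith
    then show ?thesis
    proof cases
      case 1
      then show ?thesis using assms len
        by (cases "k = 1"; cases "k = 0"; cases b)
           (simp_all add: flip_def active_def sigma_set_def hop_def nth_list_update)
    next
      case 2
      then show ?thesis using assms len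
        by (cases "k = n"; cases "k = 0"; cases b)
           (auto simp: flip_def active_def sigma_set_def hop_def nth_list_update)
    next
      case 3
      consider "k = j" | "k = Suc j" | "k \<noteq> j" "k \<noteq> Suc j" by blast
      then show ?thesis
        by cases (use 3 assms len in
          \<open>cases b; simp add: flip_def active_def sigma_set_def hop_def nth_list_update; linarith?\<close>)+
    qed
  qed
  then show ?thesis by auto
qed

lemma sigma_set_dsites:
  assumes "\<not> active n j th" "1 \<le> n" "j \<le> n"
  shows "sigma_set n j (dsites n th) = dsites n th"
  using assms by (auto simp: active_def sigma_set_def hop_def split: if_splits)

text \<open>Every bell of a spent step is at an undesignated site, where nothing parks.\<close>

lemma sigma_set_park_spent:
  assumes "spent n j th" "1 \<le> n" "j \<le> n"
  shows "sigma_set n j (park (cw_site n) (dsites n th) S) = park (cw_site n) (dsites n th) S"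
  using assms
  by (auto simp: spent_def sigma_set_def cyclic_pair.hop_park_idle[OF cyclic_pair_cw_site]
      simp del: succ_site.simps split: if_splits)

text \<open>Every bell of an active step leads to an undesignated site, from which a moved arrival
  walks straight back.\<close>

lemma park_sigma_set_active:
  assumes "active n j th" "1 \<le> n" "j \<le> n" "S \<subseteq> sites n"
  shows "park (cw_site n) (dsites n th) (sigma_set n j S) = park (cw_site n) (dsites n th) S"
proof -
  note idle = cyclic_pair.park_hop_idle[OF cyclic_pair_cw_site]
  consider "j = 0" | "j = n" "j \<noteq> 0" | "0 < j" "j < n" using assms by linarith
  then show ?thesis
  proof cases
    case 1
    then show ?thesis using assms idle[of "(True, 1)" n "dsites n th" S]
      by (simp add: active_def sigma_set_def)
  next
    case 2
    then show ?thesis using assms idle[of "(False, n)" n "dsites n th" S]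
      by (simp add: active_def sigma_set_def)
  next
    case 3
    have "bell_set n (False, j) S \<subseteq> sites n"
      using 3 assms by (intro cyclic_pair.hop_subset[OF cyclic_pair_cw_site]) auto
    with 3 show ?thesis
      using assms idle[of "(False, j)" n "dsites n th" S]
        idle[of "(True, j + 1)" n "dsites n th" "bell_set n (False, j) S"]
      by (simp add: active_def sigma_set_def)
  qed
qed

lemma park_sigma_set:
  assumes "\<not> spent n j th" "1 \<le> n" "j \<le> n" "S \<subseteq> sites n"
  shows "park (cw_site n) (sigma_set n j (dsites n th)) (sigma_set n j S)
       = sigma_set n j (park (cw_site n) (dsites n th) S)"
proof -
  note hop_hop = cyclic_pair.park_hop_hop[OF cyclic_pair_cw_site]
  consider "j = 0" | "j = n" "j \<noteq> 0" | "0 < j" "j < n" using assms by linarith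
  then show ?thesis
  proof cases
    case 1
    then show ?thesis using assms hop_hop[of "(True, 1)" n "dsites n th" S]
      by (simp add: spent_def sigma_set_def)
  next
    case 2
    then show ?thesis using assms hop_hop[of "(False, n)" n "dsites n th" S]
      by (simp add: spent_def sigma_set_def)
  next
    case 3
    have "bell_set n (False, j) S \<subseteq> sites n"
      using 3 assms by (intro cyclic_pair.hop_subset[OF cyclic_pair_cw_site]) auto
    \<comment> \<open>The first bell touches lower sites only, so the condition for the second bell
      can be read off the original signs.\<close>
    moreover have "(True, k) \<in> bell_set n (False, j) (dsites n th) \<longleftrightarrow> (True, k) \<in> dsites n th" for k
      using 3 by (auto simp: hop_def)
    ultimately show ?thesis
      using 3 assms hop_hop[of "(False, j)" n "dsites n th" S]
        hop_hop[of "(True, j + 1)" n "bell_set n (False, j) (dsites n th)" "bell_set n (False, j) S"]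
      by (auto simp: spent_def sigma_set_def)
  qed
qed

lemma wf_state_iff:
  "wf_state n x \<longleftrightarrow> dom x \<subseteq> sites n \<and> (\<forall>j. \<not> ((True, j) \<in> dom x \<and> (False, j) \<in> dom x))"
  unfolding wf_state_def by (auto simp: dom_def subset_iff split_paired_all)

lemma wf_state_dom: "wf_state n x \<Longrightarrow> dom x \<subseteq> sites n"
  by (simp add: wf_state_iff)

text \<open>Between the two bells a column may be doubly occupied: if the particle at
  \<open>L_j\<close> moves on below an occupied \<open>U_{j+1}\<close>, the second bell takes the
  upper one to \<open>U_j\<close>, which is empty since \<open>L_j\<close> was occupied.\<close>

lemma wf_state_sigma:
  assumes "wf_state n x" "1 \<le> n" "j \<le> n"
  shows "wf_state n (sigma n j x)"
proof -
  have "\<not> ((True, k) \<in> sigma_set n j X \<and> (False, k) \<in> sigma_set n j X)"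
    if "\<And>k. \<not> ((True, k) \<in> X \<and> (False, k) \<in> X)" for k X
  proof -
    consider "j = 0" | "j = n" "j \<noteq> 0" | "0 < j" "j < n" using assms by linarith
    then show ?thesis
    proof cases
      case 1
      then show ?thesis using that[of 1] that[of k]
        by (cases "k = 1") (simp_all add: sigma_set_def hop_def)
    next
      case 2
      then show ?thesis using that[of n] that[of k]
        by (cases "k = n") (simp_all add: sigma_set_def hop_def)
    next
      case 3
      consider "k = j" | "k = Suc j" | "k \<noteq> j" "k \<noteq> Suc j" by blast
      then show ?thesis
        by cases (use 3 that[of j] that[of "Suc j"] that[of k] in \<open>auto simp: sigma_set_def hop_def\<close>)
    qed
  qed
  then show ?thesis using assms by (simp add: wf_state_iff dom_sigma sigma_set_subset)
qed

lemma card_dom_le: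
  assumes "wf_state n x" shows "card (dom x) \<le> n"
proof -
  have "inj_on snd (dom x)"
  proof (rule inj_onI)
    fix s s' assume "s \<in> dom x" "s' \<in> dom x" "snd s = snd s'"
    with assms show "s = s'"
      by (cases s rule: site_cases; cases s' rule: site_cases) (auto simp: wf_state_iff)
  qed
  moreover have "snd ` dom x \<subseteq> {1..n}" using wf_state_dom[OF assms] by auto
  ultimately have "card (dom x) \<le> card {1..n}" by (intro card_inj_on_le) auto
  then show ?thesis by simp
qed

section \<open>The map \<open>tau\<close> as parking of truncations\<close>

lemma place_eq:
  assumes "hit (cw_site n) (dsites n th - dom v) s y"
  shows "place n th (c, s) v = v(y := Some c)"
proof -
  let ?A = "dsites n th - dom v"
  have mem: "t \<in> ?A \<longleftrightarrow> desig n th t \<and> v t = None" for t by (auto simp: dsites_def)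
  \<comment> \<open>The \<open>LEAST\<close> in \<open>place\<close> denotes the intended number
    only if some \<open>k\<close> qualifies; the walk recorded by \<open>hit\<close> supplies
    one.\<close>
  from assms have "\<exists>k. (cw_site n ^^ k) s \<in> ?A"
  proof (induction rule: hit.induct)
    case (here x)
    then show ?case by (intro exI[of _ 0]) simp
  next
    case (step x y)
    then obtain k where "(cw_site n ^^ k) (cw_site n x) \<in> ?A" by blast
    then show ?case by (intro exI[of _ "Suc k"]) (simp add: funpow_swap1)
  qed
  then obtain k where "(cw_site n ^^ k) s \<in> ?A" by blast
  from hit_Least[OF this] have "y = (cw_site n ^^ (LEAST k. (cw_site n ^^ k) s \<in> ?A)) s"
    using assms hit_unique by fast
  then show ?thesis unfolding mem place_def by (simp add: Let_def)
qed

text \<open>Classes arrive in nondecreasing order, so those up to \<open>c\<close> form an initial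
  stretch of \<open>ps\<close> and park unaffected by the rest. The bound on
  \<open>length ps\<close> keeps a site free for each particle.\<close>

lemma fold_place:
  assumes "sorted (map fst ps)" "distinct (map snd ps)" "snd ` set ps \<subseteq> sites n" "length ps \<le> n"
  defines "v \<equiv> \<lambda>th. fold (place n th) ps (\<lambda>_. None)"
  shows "dom (v th) = park (cw_site n) (dsites n th) (snd ` set ps) \<and>
    (\<forall>c. below c (v th) = park (cw_site n) (dsites n th) (snd ` {q \<in> set ps. fst q \<le> c}))"
  using assms(1-4) unfolding v_def
proof (induction ps rule: rev_induct)
  case Nil
  then show ?case by (simp add: below_def park_def)
next
  case (snoc q ps)
  obtain c0 s0 where q: "q = (c0, s0)" by (cases q) simp
  define v where "v = fold (place n th) ps (\<lambda>_. None)"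
  let ?D = "dsites n th" and ?f = "cw_site n"
  let ?V = "vacant ?f ?D (snd ` set ps)"
  have prems: "sorted (map fst ps)" "distinct (map snd ps)" "snd ` set ps \<subseteq> sites n"
    "length ps < n" "s0 \<in> sites n" "s0 \<notin> snd ` set ps" "\<And>q. q \<in> set ps \<Longrightarrow> fst q \<le> c0"
    using snoc.prems by (auto simp: q sorted_append)
  have dom: "dom v = park ?f ?D (snd ` set ps)"
    and below: "\<And>c. below c v = park ?f ?D (snd ` {q \<in> set ps. fst q \<le> c})"
    using snoc.IH prems unfolding v_def by auto
  have free: "?D - dom v = ?V" using vacant_subset[of ?f ?D] unfolding dom park_def by blast
  have "card (snd ` set ps) = length ps"
    using prems(2) by (metis distinct_card length_map list.set_map)
  then have "card ?V = n - length ps"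
    using ring.card_vacant[OF prems(3) dsites_subset] by (simp add: card_dsites)
  then have "?V \<noteq> {}" using prems(4) by auto
  then obtain y0 where "y0 \<in> ?V" by blast
  moreover from this have "y0 \<in> sites n" using vacant_subset[of ?f ?D "snd ` set ps"] dsites_subset[of n th] by auto
  ultimately obtain y where y: "hit ?f ?V s0 y" using ring.hit_exists[of s0 n y0 ?V] prems(5) by blast
  then have yV: "y \<in> ?V" by (rule hit_mem)
  then have y_notin: "y \<notin> dom v" "y \<in> ?D" using free by auto
  have fold: "fold (place n th) (ps @ [q]) (\<lambda>_. None) = v(y := Some c0)"
    using place_eq[of n th v s0 y c0] y free by (simp add: q v_def)
  have park: "park ?f ?D (insert s0 (snd ` set ps)) = insert y (dom v)"
    using prems(6) y y_notin yV dom by (auto simp: park_def vacant_insert take_first_hit)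
  have "below c (v(y := Some c0)) = park ?f ?D (snd ` {r \<in> set (ps @ [q]). fst r \<le> c})" for c
  proof (cases "c0 \<le> c")
    case True
    then have le: "fst r \<le> c" if "r \<in> set ps" for r using prems(7)[OF that] by simp
    then have all: "{r \<in> set (ps @ [q]). fst r \<le> c} = insert q (set ps)"
      "{r \<in> set ps. fst r \<le> c} = set ps"
      using True q by auto
    have "below c (v(y := Some c0)) = insert y (below c v)"
      using True by (auto simp: below_def)
    then show ?thesis unfolding all below using park dom by (simp add: q)
  next
    case False
    then have "{r \<in> set (ps @ [q]). fst r \<le> c} = {q \<in> set ps. fst q \<le> c}"
      by (auto simp: q)
    moreover have "below c (v(y := Some c0)) = below c v"
      using False y_notin by (auto simp: below_def)
    ultimately show ?thesis using below by simp
  qed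
  moreover have "dom (v(y := Some c0)) = park ?f ?D (snd ` set (ps @ [q]))"
    using park by (simp add: q)
  ultimately show ?case unfolding fold by blast
qed

lemma below_tau:
  assumes "wf_state n u"
  shows "below c (tau n th u) = (if c \<le> Max (insert 0 (ran u))
     then park (cw_site n) (dsites n th) (below c u) else dsites n th)"
proof -
  define P where "P = {(c, s). u s = Some c}"
  define ps where "ps = sorted_list_of_set P"
  \<comment> \<open>The default \<open>0\<close> serves an empty \<open>u\<close>, for which the
    fresh particles receive class 1.\<close>
  define m where "m = Max (insert 0 (ran u))"
  define v where "v = fold (place n th) ps (\<lambda>_. None)"
  have fin_dom: "finite (dom u)" using wf_state_dom[OF assms] finite_sites finite_subset by blast
  have P_eq: "P = (\<lambda>s. (the (u s), s)) ` dom u" by (auto simp: P_def image_iff)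
  have finP: "finite P" using fin_dom by (simp add: P_eq)
  have set_ps: "set ps = P" using finP by (simp add: ps_def)
  have snd_P: "snd ` P = dom u" by (simp add: P_eq image_image)
  have inj: "inj_on snd P" by (auto simp: P_def inj_on_def)
  have len: "length ps = card (dom u)"
    using card_image[OF inj] snd_P by (simp add: ps_def)
  \<comment> \<open>Pairs are ordered lexicographically with the class first.\<close>
  have "sorted (map fst ps)"
    using sorted_sorted_list_of_set[of P] unfolding ps_def[symmetric] sorted_map
    by (rule sorted_wrt_mono_rel[rotated]) (auto simp: less_eq_prod_def)
  moreover have "distinct (map snd ps)"
    using inj finP by (simp add: distinct_map set_ps) (simp add: ps_def)
  moreover have "snd ` {q \<in> P. fst q \<le> c} = below c u" for c
    by (force simp: P_def below_def)
  ultimately have dom_v: "dom v = park (cw_site n) (dsites n th) (dom u)"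
    and below_v: "\<And>c. below c v = park (cw_site n) (dsites n th) (below c u)"
    using fold_place[of ps n th] wf_state_dom[OF assms] card_dom_le[OF assms]
    by (simp_all add: set_ps snd_P len v_def)
  have tau: "tau n th u = (\<lambda>s. if s \<in> dsites n th \<and> v s = None then Some (m + 1) else v s)"
    unfolding tau_def Let_def v_def ps_def P_def m_def dsites_def mem_Collect_eq ..
  show ?thesis
  proof (cases "c \<le> m")
    case True
    then have "below c (tau n th u) = below c v" unfolding tau by (auto simp: below_def)
    with True below_v show ?thesis by (simp add: m_def)
  next
    case False
    have "finite (ran u)" using fin_dom by (simp add: finite_ran)
    then have "\<And>s p. u s = Some p \<Longrightarrow> p \<le> m" unfolding m_def by (auto intro!: Max_ge ranI)
    \<comment> \<open>At level \<open>m\<close> the truncation of \<open>u\<close> is all of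
      \<open>u\<close>, so parking it gives all of \<open>v\<close>; hence \<open>v\<close> has no
      class above \<open>m\<close>.\<close>
    then have "below m u = dom u" by (auto simp: below_def)
    then have "below m v = dom v" using below_v dom_v by simp
    then have "s \<in> below m v" if "v s = Some p" for s p using that domI[of v s p] by simp
    then have "p \<le> m" if "v s = Some p" for s p using that by (fastforce simp: below_def)
    moreover have "dom v \<subseteq> dsites n th" by (auto simp: dom_v park_def)
    ultimately have "below c (tau n th u) = dsites n th"
      using False unfolding tau by (force simp: below_def dom_def)
    with False show ?thesis by (simp add: m_def)
  qed
qed

section \<open>Types and cumulative counts\<close>

lemma finite_below: "finite (dom x) \<Longrightarrow> finite (below c x)"
  by (rule finite_subset[OF below_subset_dom])

lemma finite_dom: "wf_state n x \<Longrightarrow> finite (dom x)"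
  by (rule finite_subset[OF wf_state_dom finite_sites])

lemma card_below:
  assumes "finite (dom x)"
  shows "card (below c x) = (\<Sum>k\<le>c. card {s. x s = Some k})"
proof -
  have "below c x = (\<Union>k\<in>{..c}. {s. x s = Some k})" by (auto simp: below_def)
  moreover have "finite {s. x s = Some k}" for k
    by (rule finite_subset[OF _ assms]) auto
  ultimately show ?thesis by (simp add: card_UN_disjoint disjoint_iff)
qed

text \<open>Successive differences recover the counts of single classes from the cumulative ones,
  and the latter are what bells and parking visibly preserve.\<close>

lemma Omega_iff:
  "x \<in> Omega n J \<longleftrightarrow> wf_state n x \<and> (\<forall>c. card (below c x) = (\<Sum>k\<le>c. mtype n J k))"
proof -
  have sums: "(\<forall>k. f k = g k) \<longleftrightarrow> (\<forall>c. (\<Sum>k\<le>c. f k) = (\<Sum>k\<le>c. g k))" for f g :: "nat \<Rightarrow> nat"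
  proof
    assume eq: "\<forall>c. (\<Sum>k\<le>c. f k) = (\<Sum>k\<le>c. g k)"
    show "\<forall>k. f k = g k"
    proof
      fix k
      show "f k = g k"
      proof (cases k)
        case 0
        then show ?thesis using eq[rule_format, of 0] by simp
      next
        case (Suc m)
        then show ?thesis using eq[rule_format, of m] eq[rule_format, of "Suc m"] by simp
      qed
    qed
  qed simp
  show ?thesis
    unfolding Omega_def mem_Collect_eq sums[of "\<lambda>k. card {s. x s = Some k}" "mtype n J"]
    by (rule conj_cong[OF refl]) (simp add: card_below finite_dom)
qed

lemma Omega_wf: "x \<in> Omega n J \<Longrightarrow> wf_state n x"
  by (simp add: Omega_def)

lemma sigma_Omega:
  assumes "x \<in> Omega n J" "1 \<le> n" "j \<le> n"
  shows "sigma n j x \<in> Omega n J"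
  using assms finite_below[OF finite_dom[OF Omega_wf[OF assms(1)]]]
  by (simp add: Omega_iff wf_state_sigma below_sigma card_sigma_set)

lemma new_class_le: "1 \<le> i \<Longrightarrow> new_class n J i \<le> i"
proof -
  assume "1 \<le> i"
  have "card {j. 1 \<le> j \<and> j < i \<and> j \<notin> J} \<le> card {1..<i}" by (intro card_mono) auto
  with \<open>1 \<le> i\<close> show ?thesis by (simp add: new_class_def)
qed

lemma finite_classes: "finite {j. 1 \<le> j \<and> j < (i::nat) \<and> j \<notin> J}"
  by (rule finite_subset[of _ "{1..<i}"]) auto

lemma new_class_mono: "i \<le> i' \<Longrightarrow> new_class n J i \<le> new_class n J i'"
  unfolding new_class_def by (intro add_left_mono card_mono finite_classes) auto

lemma new_class_insert: "i \<le> n \<Longrightarrow> new_class n (insert n J) i = new_class n J i"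
proof -
  assume "i \<le> n"
  then have "{j. 1 \<le> j \<and> j < i \<and> j \<notin> insert n J} = {j. 1 \<le> j \<and> j < i \<and> j \<notin> J}" by auto
  then show ?thesis by (simp only: new_class_def)
qed

text \<open>The witness is \<open>M\<close>, the largest index below \<open>n\<close> outside
  \<open>J\<close>: the block of identified classes that contains \<open>n\<close> begins right
  after it.\<close>

lemma new_class_pred:
  assumes "new_class n J n > 1"
  obtains i where "1 \<le> i" "i \<le> n" "Suc (new_class n J i) = new_class n J n"
proof -
  let ?S = "{j. 1 \<le> j \<and> j < n \<and> j \<notin> J}"
  have "?S \<noteq> {}" using assms by (auto simp: new_class_def simp del: One_nat_def dest: card_gt_0_iff[THEN iffD1])
  define M where "M = Max ?S"
  have mem: "M \<in> ?S" unfolding M_def using \<open>?S \<noteq> {}\<close> by (intro Max_in finite_classes)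
  have le: "j \<le> M" if "j \<in> ?S" for j unfolding M_def by (rule Max_ge[OF finite_classes that])
  have "?S = insert M {j. 1 \<le> j \<and> j < M \<and> j \<notin> J}"
    using mem le by (auto simp: le_less)
  then have "card ?S = Suc (card {j. 1 \<le> j \<and> j < M \<and> j \<notin> J})"
    by (metis (no_types, lifting) card_insert_disjoint finite_classes less_irrefl mem_Collect_eq)
  with mem that[of M] show thesis by (auto simp: new_class_def)
qed

lemma sum_mtype:
  "(\<Sum>k\<le>c. mtype n J k) = card {i. 1 \<le> i \<and> i \<le> n \<and> new_class n J i \<le> c \<and>
      \<not> (n \<in> J \<and> new_class n J i = new_class n J n)}"
proof -
  let ?A = "\<lambda>k. {i. 1 \<le> i \<and> i \<le> n \<and> new_class n J i = k \<and>
      \<not> (n \<in> J \<and> new_class n J i = new_class n J n)}"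
  have "finite (?A k)" for k by (rule finite_subset[of _ "{1..n}"]) auto
  then have "card (\<Union>k\<in>{..c}. ?A k) = (\<Sum>k\<le>c. mtype n J k)"
    unfolding mtype_def by (subst card_UN_disjoint) auto
  also have "(\<Union>k\<in>{..c}. ?A k) = {i. 1 \<le> i \<and> i \<le> n \<and> new_class n J i \<le> c \<and>
      \<not> (n \<in> J \<and> new_class n J i = new_class n J n)}" by auto
  finally show ?thesis by simp
qed

lemma mtype_pos_iff:
  "mtype n J k > 0 \<longleftrightarrow> (\<exists>i. 1 \<le> i \<and> i \<le> n \<and> new_class n J i = k \<and>
      \<not> (n \<in> J \<and> new_class n J i = new_class n J n))"
proof -
  have "finite {i. 1 \<le> i \<and> i \<le> n \<and> new_class n J i = k \<and>
      \<not> (n \<in> J \<and> new_class n J i = new_class n J n)}"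
    by (rule finite_subset[of _ "{1..n}"]) auto
  then show ?thesis unfolding mtype_def by (subst card_gt_0_iff) auto
qed

lemma in_ran_Omega:
  assumes "x \<in> Omega n J"
  shows "k \<in> ran x \<longleftrightarrow> mtype n J k > 0"
proof -
  have "finite {s. x s = Some k}"
    by (rule finite_subset[OF _ finite_dom[OF Omega_wf[OF assms]]]) auto
  then have "card {s. x s = Some k} > 0 \<longleftrightarrow> k \<in> ran x"
    by (auto simp: card_gt_0_iff ran_def)
  with assms show ?thesis by (simp add: Omega_def)
qed

lemma class_le_Omega:
  assumes "x \<in> Omega n J" "x s = Some k"
  shows "k \<le> n"
proof -
  have "k \<in> ran x" using assms(2) by (rule ranI)
  then have "mtype n J k > 0" using in_ran_Omega[OF assms(1)] by simp
  then show ?thesis using new_class_le by (fastforce simp: mtype_pos_iff intro: order_trans)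
qed

lemma finite_Omega: "finite (Omega n J)"
proof -
  have "Omega n J \<subseteq> {x. \<forall>s. (s \<in> sites n \<longrightarrow> x s \<in> insert None (Some ` {..n})) \<and> (s \<notin> sites n \<longrightarrow> x s = None)}"
  proof
    fix x assume x: "x \<in> Omega n J"
    have "x s \<in> insert None (Some ` {..n})" for s
      using class_le_Omega[OF x, of s] by (cases "x s") auto
    moreover have "s \<notin> sites n \<Longrightarrow> x s = None" for s
      using wf_state_dom[OF Omega_wf[OF x]] by auto
    ultimately show "x \<in> {x. \<forall>s. (s \<in> sites n \<longrightarrow> x s \<in> insert None (Some ` {..n})) \<and> (s \<notin> sites n \<longrightarrow> x s = None)}"
      by blast
  qed
  moreover have "finite {x. \<forall>s. (s \<in> sites n \<longrightarrow> x s \<in> insert None (Some ` {..n})) \<and> (s \<notin> sites n \<longrightarrow> x s = None)}"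
    by (rule finite_set_of_finite_funs) auto
  ultimately show ?thesis by (rule finite_subset)
qed

lemma Omega_nonempty: "Omega n J \<noteq> {}"
proof -
  let ?kept = "\<lambda>i. 1 \<le> i \<and> i \<le> n \<and> \<not> (n \<in> J \<and> new_class n J i = new_class n J n)"
  define x :: state where
    "x s = (if \<not> fst s \<and> ?kept (snd s) then Some (new_class n J (snd s)) else None)" for s
  have "card {s. x s = Some k} = mtype n J k" for k
  proof -
    have "{s. x s = Some k} = Pair False ` {i. 1 \<le> i \<and> i \<le> n \<and> new_class n J i = k \<and>
      \<not> (n \<in> J \<and> new_class n J i = new_class n J n)}"
      by (auto simp: x_def split: if_splits)
    then show ?thesis by (simp add: mtype_def card_image inj_on_def)
  qed
  moreover have "wf_state n x" by (auto simp: wf_state_def x_def)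
  ultimately have "x \<in> Omega n J" by (simp add: Omega_def)
  then show ?thesis by blast
qed

text \<open>The class just before that of \<open>n\<close> occurs, and the class of \<open>n\<close>
  is removed. If it was the only class, \<open>u\<close> is empty and the inserted \<open>0\<close>
  is the maximum.\<close>

lemma Max_class:
  assumes "u \<in> Omega n (insert n J)"
  shows "Max (insert 0 (ran u)) = new_class n J n - 1"
proof (rule Max_eqI)
  show "finite (insert 0 (ran u))" using finite_dom[OF Omega_wf[OF assms]] by (simp add: finite_ran)
next
  fix k assume "k \<in> insert 0 (ran u)"
  then show "k \<le> new_class n J n - 1"
  proof
    assume "k \<in> ran u"
    then have "mtype n (insert n J) k > 0" using in_ran_Omega[OF assms] by simp
    then obtain i where "i \<le> n" "new_class n J i = k" "k \<noteq> new_class n J n"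
      by (auto simp: mtype_pos_iff new_class_insert)
    then show ?thesis using new_class_mono[of i n n J] by linarith
  qed simp
next
  show "new_class n J n - 1 \<in> insert 0 (ran u)"
  proof (cases "new_class n J n > 1")
    case True
    then obtain i where "1 \<le> i" "i \<le> n" "Suc (new_class n J i) = new_class n J n"
      by (rule new_class_pred)
    then have "mtype n (insert n J) (new_class n J n - 1) > 0"
      by (auto simp: mtype_pos_iff new_class_insert intro!: exI[of _ i])
    then show ?thesis using in_ran_Omega[OF assms] by simp
  qed simp
qed

text \<open>The threshold no longer depends on \<open>u\<close>, so one case distinction serves both
  \<open>u\<close> and \<open>sigma n j u\<close>.\<close>

lemma below_tau_Omega:
  assumes "u \<in> Omega n (insert n J)"
  shows "below c (tau n th u) = (if c < new_class n J n
     then park (cw_site n) (dsites n th) (below c u) else dsites n th)"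
proof -
  have "new_class n J n > 0" by (simp add: new_class_def)
  then have "c \<le> new_class n J n - 1 \<longleftrightarrow> c < new_class n J n" by linarith
  then show ?thesis using below_tau[OF Omega_wf[OF assms]] Max_class[OF assms] by simp
qed

lemma below_sites: "wf_state n u \<Longrightarrow> below c u \<subseteq> sites n"
  by (erule order_trans[OF below_subset_dom wf_state_dom])

text \<open>Parking uses one site per column. Below the class of \<open>n\<close> it preserves
  counts, and there the types for \<open>J\<close> and \<open>insert n J\<close> agree; from that
  class on, all \<open>n\<close> designated sites are occupied.\<close>

lemma tau_Omega:
  assumes u: "u \<in> Omega n (insert n J)" and n: "n \<notin> J"
  shows "tau n th u \<in> Omega n J"
proof -
  note wf = Omega_wf[OF u]
  have sub: "below c (tau n th u) \<subseteq> dsites n th" for c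
    using below_tau_Omega[OF u, of c th] Diff_subset
    by (cases "c < new_class n J n") (simp_all only: park_def if_True if_False order_refl)
  have dom: "dom (tau n th u) \<subseteq> dsites n th"
  proof
    fix s assume "s \<in> dom (tau n th u)"
    then obtain p where "tau n th u s = Some p" by auto
    then have "s \<in> below p (tau n th u)" by (simp add: below_def)
    then show "s \<in> dsites n th" using sub by (rule rev_subsetD)
  qed
  have "wf_state n (tau n th u)"
    unfolding wf_state_iff
  proof (intro conjI allI notI)
    show "dom (tau n th u) \<subseteq> sites n" using dom dsites_subset by (rule order_trans)
    fix j assume "(True, j) \<in> dom (tau n th u) \<and> (False, j) \<in> dom (tau n th u)"
    then have "(True, j) \<in> dsites n th" "(False, j) \<in> dsites n th"
      using subsetD[OF dom] by (simp_all only:)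
    then show False by simp
  qed
  moreover have "card (below c (tau n th u)) = (\<Sum>k\<le>c. mtype n J k)" for c
  proof (cases "c < new_class n J n")
    case True
    have "card (below c u) \<le> card (dom u)"
      by (intro card_mono finite_dom[OF wf] below_subset_dom)
    also have "\<dots> \<le> n" by (rule card_dom_le[OF wf])
    finally have "card (below c (tau n th u)) = card (below c u)"
      unfolding below_tau_Omega[OF u] using True below_sites[OF wf] dsites_subset
      by (simp add: ring.card_park card_dsites)
    also have "\<dots> = (\<Sum>k\<le>c. mtype n (insert n J) k)" using u by (simp add: Omega_iff)
    also have "\<dots> = (\<Sum>k\<le>c. mtype n J k)"
      unfolding sum_mtype
      using True n by (intro arg_cong[where f = card] Collect_cong) (auto simp: new_class_insert)
    finally show ?thesis .
  next
    case False
    have "{i. 1 \<le> i \<and> i \<le> n \<and> new_class n J i \<le> c \<and>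
      \<not> (n \<in> J \<and> new_class n J i = new_class n J n)} = {1..n}"
      using False n new_class_mono[of _ n n J] by (fastforce intro: order_trans)
    with False show ?thesis
      unfolding sum_mtype by (simp add: below_tau_Omega[OF u] card_dsites)
  qed
  ultimately show ?thesis by (simp add: Omega_iff)
qed

section \<open>Four relations between \<open>tau\<close> and \<open>sigma\<close>\<close>

context
  fixes n j :: nat and J :: "nat set" and u :: state and th :: "bool list"
  assumes u: "u \<in> Omega n (insert n J)" and n: "1 \<le> n" and j: "j \<le> n" and th: "th \<in> signs n"
begin

private lemmas below_simps =
  below_sigma[OF n j] below_tau_Omega[OF u] below_tau_Omega[OF sigma_Omega[OF u n j]]

private lemma sub: "below c u \<subseteq> sites n"
  by (rule below_sites[OF Omega_wf[OF u]])

text \<open>Below the fresh class this is \<open>park_sigma_set\<close>, with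
  \<open>dsites_flip\<close> describing the moved designated sites; from the fresh class on it is
  \<open>dsites_flip\<close> alone.\<close>

lemma tau_sigma_flip:
  assumes "active n j th"
  shows "tau n (flip n j th) (sigma n j u) = sigma n j (tau n th u)"
proof (rule state_eqI)
  have "\<not> spent n j th" using assms by (auto simp: active_def spent_def split: if_splits)
  then show "below c (tau n (flip n j th) (sigma n j u)) = below c (sigma n j (tau n th u))" for c
    by (simp add: below_simps dsites_flip[OF th n j assms] park_sigma_set[OF _ n j sub])
qed

lemma tau_sigma_commute:
  assumes "\<not> active n j th" "\<not> spent n j th"
  shows "tau n th (sigma n j u) = sigma n j (tau n th u)"
proof (rule state_eqI)
  show "below c (tau n th (sigma n j u)) = below c (sigma n j (tau n th u))" for c
    using park_sigma_set[OF assms(2) n j sub[of c]]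
    by (simp add: below_simps sigma_set_dsites[OF assms(1) n j])
qed

lemma tau_sigma_active:
  assumes "active n j th"
  shows "tau n th (sigma n j u) = tau n th u"
proof (rule state_eqI)
  show "below c (tau n th (sigma n j u)) = below c (tau n th u)" for c
    by (simp add: below_simps park_sigma_set_active[OF assms n j sub])
qed

lemma sigma_tau_spent:
  assumes "spent n j th"
  shows "sigma n j (tau n th u) = tau n th u"
proof (rule state_eqI)
  have "\<not> active n j th" using assms by (auto simp: active_def spent_def split: if_splits)
  then show "below c (sigma n j (tau n th u)) = below c (tau n th u)" for c
    by (simp add: below_simps sigma_set_park_spent[OF assms n j] sigma_set_dsites[OF _ n j])
qed

end

section \<open>The matrix identity\<close>

text \<open>With \<open>e\<close> the indicator of a plus sign, the difference telescopes: inner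
  \<open>j\<close> contribute \<open>2 * (e j - e (j - 1))\<close>, the ends
  \<open>2 * e 0 - 1\<close> and \<open>1 - 2 * e (n - 1)\<close>. The double rate of inner steps
  makes the total vanish.\<close>

lemma active_spent_balance:
  assumes "n \<ge> 2"
  shows "(\<Sum>j\<in>{0..n}. if active n j th then rate n j else 0) = (\<Sum>j\<in>{0..n}. if spent n j th then rate n j else 0)"
proof -
  define a b where "a = (\<Sum>j\<in>{0..n}. if active n j th then rate n j else 0)"
    and "b = (\<Sum>j\<in>{0..n}. if spent n j th then rate n j else 0)"
  define e where "e i = (if th ! i then 1 else 0 :: int)" for i
  have split: "(\<Sum>j\<in>{0..n}. f j) = f 0 + (\<Sum>j\<in>{1..<n}. f j) + f n" for f :: "nat \<Rightarrow> int"
  proof -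
    have "{0..n} = insert 0 (insert n {1..<n})" using assms by auto
    then show ?thesis using assms by simp
  qed
  have "int a - int b
      = (\<Sum>j\<in>{0..n}. int (if active n j th then rate n j else 0) - int (if spent n j th then rate n j else 0))"
    by (simp add: a_def b_def sum_subtractf)
  also have "\<dots> = (2 * e 0 - 1) + (\<Sum>j\<in>{1..<n}. 2 * (e j - e (j - 1))) + (1 - 2 * e (n - 1))"
    unfolding split
    by (intro arg_cong2[where f = "(+)"] sum.cong)
       (use assms in \<open>auto simp: active_def spent_def rate_def e_def\<close>)
  also have "(\<Sum>j\<in>{1..<n}. 2 * (e j - e (j - 1))) = 2 * (e (n - 1) - e 0)"
  proof -
    have "(\<Sum>j\<in>{1..<n}. e j - e (j - 1)) = (\<Sum>j<n - 1. e (Suc j) - e j)"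
      by (rule sum.reindex_bij_witness[of _ Suc "\<lambda>j. j - 1"]) auto
    also have "\<dots> = e (n - 1) - e 0" by (rule sum_lessThan_telescope)
    finally show ?thesis by (simp only: sum_distrib_left[symmetric])
  qed
  finally have "a = b" by simp
  then show ?thesis by (simp only: a_def b_def)
qed

lemma finite_signs: "finite (signs n)"
  using finite_lists_length_eq[of "UNIV :: bool set" n] by (simp add: signs_def)

lemma card_signs: "card (signs n) = 2 ^ n"
  using card_lists_length_eq[of "UNIV :: bool set" n] by (simp add: signs_def)

lemma Umat_eq_sum: "Umat n v u = (\<Sum>th\<in>signs n. if tau n th u = v then 1 else 0)"
  by (simp add: Umat_def sum.If_cases finite_signs Int_def)

text \<open>\<open>flip\<close> pairs the active terms on the left with the spent ones on the right.
  The unpaired terms collapse to counts of \<open>tau n th u = v\<close>, each added to the other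
  side to avoid subtraction; they cancel only after summing over \<open>j\<close>.\<close>

lemma sigma_tau_count:
  assumes u: "u \<in> Omega n (insert n J)" and n: "1 \<le> n" and j: "j \<le> n"
  shows "(\<Sum>th\<in>signs n. if sigma n j (tau n th u) = v then 1 else 0 :: nat)
      + (\<Sum>th\<in>signs n. if active n j th then (if tau n th u = v then 1 else 0) else 0)
      = Umat n v (sigma n j u)
      + (\<Sum>th\<in>signs n. if spent n j th then (if tau n th u = v then 1 else 0) else 0)"
proof -
  define f g h :: "bool list \<Rightarrow> nat" where "f th = (if sigma n j (tau n th u) = v then 1 else 0)"
    and "g th = (if tau n th (sigma n j u) = v then 1 else 0)"
    and "h th = (if tau n th u = v then 1 else 0)" for th
  define A S E where "A = {th \<in> signs n. active n j th}" and "S = {th \<in> signs n. spent n j th}"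
    and "E = {th \<in> signs n. \<not> active n j th \<and> \<not> spent n j th}"
  have disj: "\<not> (active n j th \<and> spent n j th)" for th
    by (auto simp: active_def spent_def)
  have fin: "finite A" "finite S" "finite E" by (auto simp: A_def S_def E_def finite_signs)
  have split: "sum F (signs n) = sum F A + sum F S + sum F E" for F :: "bool list \<Rightarrow> nat"
  proof -
    have "signs n = (A \<union> S) \<union> E" by (auto simp: A_def S_def E_def)
    moreover have "(A \<union> S) \<inter> E = {}" "A \<inter> S = {}" using disj by (auto simp: A_def S_def E_def)
    ultimately show ?thesis using fin by (simp add: sum.union_disjoint)
  qed
  have flip: "spent n j (flip n j th) \<longleftrightarrow> active n j th"
    "active n j (flip n j th) \<longleftrightarrow> spent n j th" if "th \<in> signs n" for th
    using that spent_flip[of th n j] spent_flip[of "flip n j th" n j] flip_flip[of th n j]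
      flip_in_signs[of th n j] n j by auto
  have "sum f A = sum g S"
    by (rule sum.reindex_bij_witness[of _ "flip n j" "flip n j"])
       (use tau_sigma_flip[OF u n j] n j in
         \<open>auto simp: A_def S_def f_def g_def flip flip_flip flip_in_signs\<close>)
  moreover have "sum g A = sum h A"
    by (rule sum.cong) (use tau_sigma_active[OF u n j] in \<open>auto simp: A_def g_def h_def\<close>)
  moreover have "sum f S = sum h S"
    by (rule sum.cong) (use sigma_tau_spent[OF u n j] in \<open>auto simp: S_def f_def h_def\<close>)
  moreover have "sum f E = sum g E"
    by (rule sum.cong) (use tau_sigma_commute[OF u n j] in \<open>auto simp: E_def f_def g_def\<close>)
  ultimately have "sum f (signs n) + sum h A = sum g (signs n) + sum h S"
    by (simp add: split)
  moreover have "sum h A = (\<Sum>th\<in>signs n. if active n j th then h th else 0)"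
    "sum h S = (\<Sum>th\<in>signs n. if spent n j th then h th else 0)"
    by (simp_all add: A_def S_def sum.inter_filter finite_signs)
  ultimately show ?thesis unfolding f_def g_def h_def Umat_eq_sum by (simp only:)
qed

text \<open>The weights lie in a general semiring: natural numbers are used for the matrix identity,
  reals for stationarity.\<close>

lemma sum_Mmat:
  fixes g :: "state \<Rightarrow> 'a :: comm_semiring_1"
  assumes "u \<in> Omega n J" "1 \<le> n"
  shows "(\<Sum>w\<in>Omega n J. g w * of_nat (Mmat n J w u)) = (\<Sum>j\<in>{0..n}. of_nat (rate n j) * g (sigma n j u))"
proof -
  have "(\<Sum>w\<in>Omega n J. g w * of_nat (Mmat n J w u))
      = (\<Sum>w\<in>Omega n J. \<Sum>j\<in>{0..n}. if sigma n j u = w then of_nat (rate n j) * g w else 0)"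
    using assms by (intro sum.cong refl) (auto simp: Mmat_def sum_distrib_left mult.commute intro!: sum.cong)
  also have "\<dots> = (\<Sum>j\<in>{0..n}. \<Sum>w\<in>Omega n J. if sigma n j u = w then of_nat (rate n j) * g w else 0)"
    by (rule sum.swap)
  also have "\<dots> = (\<Sum>j\<in>{0..n}. of_nat (rate n j) * g (sigma n j u))"
    using assms sigma_Omega by (intro sum.cong refl) (auto simp: finite_Omega)
  finally show ?thesis .
qed

lemma sum_Umat:
  fixes g :: "state \<Rightarrow> 'a :: comm_semiring_1"
  assumes "u \<in> Omega n (insert n J)" "n \<notin> J"
  shows "(\<Sum>w\<in>Omega n J. g w * of_nat (Umat n w u)) = (\<Sum>th\<in>signs n. g (tau n th u))"
proof -
  have "(\<Sum>w\<in>Omega n J. g w * of_nat (Umat n w u))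
      = (\<Sum>w\<in>Omega n J. \<Sum>th\<in>signs n. if tau n th u = w then g w else 0)"
    by (intro sum.cong refl) (auto simp: Umat_eq_sum sum_distrib_left intro!: sum.cong)
  also have "\<dots> = (\<Sum>th\<in>signs n. \<Sum>w\<in>Omega n J. if tau n th u = w then g w else 0)"
    by (rule sum.swap)
  also have "\<dots> = (\<Sum>th\<in>signs n. g (tau n th u))"
    using tau_Omega[OF assms] by (intro sum.cong refl) (auto simp: finite_Omega)
  finally show ?thesis .
qed

lemma Umat_intertwines:
  assumes n: "n \<ge> 2" "n \<notin> J" and v: "v \<in> Omega n J" and u: "u \<in> Omega n (insert n J)"
  shows "(\<Sum>w\<in>Omega n (insert n J). Umat n v w * Mmat n (insert n J) w u)
       = (\<Sum>w\<in>Omega n J. Mmat n J v w * Umat n w u)"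
proof -
  define h :: "bool list \<Rightarrow> nat" where "h th = (if tau n th u = v then 1 else 0)" for th
  define X where "X P = (\<Sum>j\<in>{0..n}. rate n j * (\<Sum>th\<in>signs n. if P j th then h th else 0))"
    for P :: "nat \<Rightarrow> bool list \<Rightarrow> bool"
  \<comment> \<open>Exchanging the sums exposes, for each \<open>th\<close>, the total rate of the
    \<open>j\<close> with \<open>P j th\<close>; this is where \<open>active_spent_balance\<close>
    applies.\<close>
  have X: "X P = (\<Sum>th\<in>signs n. h th * (\<Sum>j\<in>{0..n}. if P j th then rate n j else 0))" for P
  proof -
    have "X P = (\<Sum>j\<in>{0..n}. \<Sum>th\<in>signs n. if P j th then rate n j * h th else 0)"
      unfolding X_def sum_distrib_left by (intro sum.cong refl) auto
    also have "\<dots> = (\<Sum>th\<in>signs n. \<Sum>j\<in>{0..n}. if P j th then rate n j * h th else 0)"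
      by (rule sum.swap)
    also have "\<dots> = (\<Sum>th\<in>signs n. h th * (\<Sum>j\<in>{0..n}. if P j th then rate n j else 0))"
      unfolding sum_distrib_left by (intro sum.cong refl) auto
    finally show ?thesis .
  qed
  have balance: "X (active n) = X (spent n)"
    unfolding X active_spent_balance[OF n(1)] ..
  have "(\<Sum>w\<in>Omega n J. Mmat n J v w * Umat n w u) = (\<Sum>th\<in>signs n. Mmat n J v (tau n th u))"
    using sum_Umat[OF u n(2), of "Mmat n J v"] by simp
  also have "\<dots> = (\<Sum>th\<in>signs n. \<Sum>j\<in>{0..n}. rate n j * (if sigma n j (tau n th u) = v then 1 else 0))"
    using v tau_Omega[OF u n(2)] by (intro sum.cong refl) (auto simp: Mmat_def intro!: sum.cong)
  also have "\<dots> = (\<Sum>j\<in>{0..n}. rate n j * (\<Sum>th\<in>signs n. if sigma n j (tau n th u) = v then 1 else 0))"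
    unfolding sum_distrib_left by (rule sum.swap)
  finally have "(\<Sum>w\<in>Omega n J. Mmat n J v w * Umat n w u) + X (active n)
      = (\<Sum>j\<in>{0..n}. rate n j * ((\<Sum>th\<in>signs n. if sigma n j (tau n th u) = v then 1 else 0)
          + (\<Sum>th\<in>signs n. if active n j th then h th else 0)))"
    by (simp only: X_def sum.distrib distrib_left)
  also have "\<dots> = (\<Sum>j\<in>{0..n}. rate n j * (Umat n v (sigma n j u)
          + (\<Sum>th\<in>signs n. if spent n j th then h th else 0)))"
  proof (intro sum.cong refl arg_cong2[where f = "(*)"])
    fix j assume "j \<in> {0..n}"
    then show "(\<Sum>th\<in>signs n. if sigma n j (tau n th u) = v then 1 else 0)
          + (\<Sum>th\<in>signs n. if active n j th then h th else 0)
       = Umat n v (sigma n j u) + (\<Sum>th\<in>signs n. if spent n j th then h th else 0)"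
      unfolding h_def using sigma_tau_count[OF u, of j v] n by simp
  qed
  also have "\<dots> = (\<Sum>j\<in>{0..n}. rate n j * Umat n v (sigma n j u)) + X (spent n)"
    by (simp only: X_def sum.distrib distrib_left)
  also have "(\<Sum>j\<in>{0..n}. rate n j * Umat n v (sigma n j u))
      = (\<Sum>w\<in>Omega n (insert n J). Umat n v w * Mmat n (insert n J) w u)"
    using sum_Mmat[OF u, of "Umat n v"] n by simp
  finally show ?thesis using balance by simp
qed

section \<open>Stationary distributions\<close>

text \<open>Existence goes by eliminating one state at a time: the chain watched outside \<open>z\<close> has the
  extra rates \<open>K x z * K z y / out z\<close>.\<close>
lemma stationary_exists:
  fixes K :: "'a \<Rightarrow> 'a \<Rightarrow> real"
  assumes "finite A" "A \<noteq> {}" and "\<And>x y. K x y \<ge> 0"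
  shows "\<exists>p. (\<forall>x\<in>A. p x \<ge> 0) \<and> (\<exists>x\<in>A. p x > 0) \<and>
     (\<forall>x\<in>A. (\<Sum>y\<in>A. K x y * p y) = p x * (\<Sum>y\<in>A. K y x))"
  using assms
proof (induction A arbitrary: K rule: finite_ne_induct)
  case (singleton x)
  show ?case by (rule exI[of _ "\<lambda>_. 1"]) simp
next
  case (insert z A)
  define out where "out = (\<Sum>x\<in>A. K x z)"
  have out_nonneg: "out \<ge> 0" unfolding out_def by (intro sum_nonneg insert.prems)
  show ?case
  proof (cases "out = 0")
    case True
    then have "K x z = 0" if "x \<in> A" for x
      using that insert.hyps insert.prems unfolding out_def by (simp add: sum_nonneg_eq_0_iff)
    moreover have "(\<Sum>y\<in>A. K x y * (if y = z then 1 else 0)) = 0" for x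
      using insert.hyps by (intro sum.neutral) auto
    \<comment> \<open>Nothing leads from \<open>z\<close> into \<open>A\<close>, so the point mass
      at \<open>z\<close> is stationary.\<close>
    ultimately show ?thesis using insert.hyps
      by (intro exI[of _ "\<lambda>x. if x = z then 1 else 0"]) auto
  next
    case False
    with out_nonneg have out: "out > 0" by simp
    define K' where "K' x y = K x y + K x z * K z y / out" for x y
    have "K' x y \<ge> 0" for x y using insert.prems out by (simp add: K'_def)
    from insert.IH[of K', OF this] obtain p where
      p: "\<And>x. x \<in> A \<Longrightarrow> p x \<ge> 0" "\<exists>x\<in>A. p x > 0"
         "\<And>x. x \<in> A \<Longrightarrow> (\<Sum>y\<in>A. K' x y * p y) = p x * (\<Sum>y\<in>A. K' y x)"
      by metis
    \<comment> \<open>The value at \<open>z\<close> is forced by balance there: the outflow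
      \<open>out * q z\<close> equals the inflow from \<open>A\<close>.\<close>
    define q where "q x = (if x = z then (\<Sum>y\<in>A. K z y * p y) / out else p x)" for x
    have qA: "(\<Sum>y\<in>A. K x y * q y) = (\<Sum>y\<in>A. K x y * p y)" for x
      using insert.hyps by (intro sum.cong) (auto simp: q_def)
    have qz: "out * q z = (\<Sum>y\<in>A. K z y * p y)" using out by (simp add: q_def)
    have col: "(\<Sum>y\<in>A. K' y x) = (\<Sum>y\<in>A. K y x) + K z x" for x
    proof -
      have "(\<Sum>y\<in>A. K y z * K z x / out) = out * K z x / out"
        by (simp add: out_def sum_distrib_right sum_divide_distrib)
      with out show ?thesis by (simp add: K'_def sum.distrib)
    qed
    have row: "(\<Sum>y\<in>A. K' x y * p y) = (\<Sum>y\<in>A. K x y * p y) + K x z * q z" for x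
    proof -
      have "K x z * (\<Sum>y\<in>A. K z y * p y) / out = (\<Sum>y\<in>A. K x z * K z y / out * p y)"
        by (simp add: sum_distrib_left sum_divide_distrib algebra_simps)
      then show ?thesis
        by (simp add: K'_def q_def algebra_simps sum.distrib)
    qed
    have nz: "z \<notin> A" "finite A" using insert.hyps by auto
    show ?thesis
    proof (intro exI[of _ q] conjI ballI)
      fix x assume "x \<in> insert z A"
      then show "q x \<ge> 0"
        using p(1) out insert.prems by (auto simp: q_def intro!: sum_nonneg divide_nonneg_pos)
    next
      from p(2) nz show "\<exists>x\<in>insert z A. q x > 0" by (auto simp: q_def)
    next
      fix x assume x: "x \<in> insert z A"
      show "(\<Sum>y\<in>insert z A. K x y * q y) = q x * (\<Sum>y\<in>insert z A. K y x)"
      proof (cases "x = z")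
        case True
        then show ?thesis using nz qA[of z] qz
          by (simp add: out_def[symmetric] algebra_simps)
      next
        case False
        then have "x \<in> A" "q x = p x" using x by (auto simp: q_def)
        then show ?thesis using nz qA[of x] p(3)[of x] row[of x] col[of x]
          by (simp add: algebra_simps)
      qed
    qed
  qed
qed

text \<open>Positive and negative part of the difference of two stationary distributions are
  again stationary, with disjoint supports that are closed under transitions.\<close>
lemma stationary_unique:
  fixes K :: "'a \<Rightarrow> 'a \<Rightarrow> real"
  assumes fin: "finite A" and nonneg: "\<And>x y. K x y \<ge> 0"
    and p: "\<And>x. x \<in> A \<Longrightarrow> (\<Sum>y\<in>A. K x y * p y) = p x * (\<Sum>y\<in>A. K y x)"
    and q: "\<And>x. x \<in> A \<Longrightarrow> (\<Sum>y\<in>A. K x y * q y) = q x * (\<Sum>y\<in>A. K y x)"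
    and eq: "(\<Sum>x\<in>A. p x) = (\<Sum>x\<in>A. q x)"
    and meet: "\<And>B C. B \<subseteq> A \<Longrightarrow> C \<subseteq> A \<Longrightarrow> B \<noteq> {} \<Longrightarrow> C \<noteq> {}
      \<Longrightarrow> (\<And>x y. y \<in> B \<Longrightarrow> x \<in> A \<Longrightarrow> K x y > 0 \<Longrightarrow> x \<in> B)
      \<Longrightarrow> (\<And>x y. y \<in> C \<Longrightarrow> x \<in> A \<Longrightarrow> K x y > 0 \<Longrightarrow> x \<in> C) \<Longrightarrow> B \<inter> C \<noteq> {}"
    and "x \<in> A"
  shows "p x = q x"
proof (rule ccontr)
  assume neq: "p x \<noteq> q x"
  define d where "d x = p x - q x" for x
  have d: "(\<Sum>y\<in>A. K x y * d y) = d x * (\<Sum>y\<in>A. K y x)" if "x \<in> A" for x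
    using p[OF that] q[OF that] by (simp add: d_def algebra_simps sum_subtractf)
  have sum0: "(\<Sum>x\<in>A. d x) = 0" using eq by (simp add: d_def sum_subtractf)
  have le: "\<bar>d x\<bar> * (\<Sum>y\<in>A. K y x) \<le> (\<Sum>y\<in>A. K x y * \<bar>d y\<bar>)" if "x \<in> A" for x
  proof -
    have "\<bar>d x\<bar> * (\<Sum>y\<in>A. K y x) = \<bar>\<Sum>y\<in>A. K x y * d y\<bar>"
      using d[OF that] nonneg by (simp add: abs_mult sum_nonneg)
    also have "\<dots> \<le> (\<Sum>y\<in>A. \<bar>K x y * d y\<bar>)" by (rule sum_abs)
    finally show ?thesis using nonneg by (simp add: abs_mult)
  qed
  \<comment> \<open>Summed over \<open>x\<close>, both sides of \<open>le\<close> are the same total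
    flow, so equality holds at every \<open>x\<close> and the absolute value of \<open>d\<close>
    satisfies the balance equations too.\<close>
  have "(\<Sum>x\<in>A. \<bar>d x\<bar> * (\<Sum>y\<in>A. K y x)) = (\<Sum>x\<in>A. \<Sum>y\<in>A. K x y * \<bar>d y\<bar>)"
    using sum.swap[of "\<lambda>x y. K x y * \<bar>d y\<bar>" A A] by (simp add: sum_distrib_left mult.commute)
  then have abs: "(\<Sum>y\<in>A. K x y * \<bar>d y\<bar>) = \<bar>d x\<bar> * (\<Sum>y\<in>A. K y x)" if "x \<in> A" for x
    using sum_mono_inv[of "\<lambda>x. \<bar>d x\<bar> * (\<Sum>y\<in>A. K y x)" A "\<lambda>x. \<Sum>y\<in>A. K x y * \<bar>d y\<bar>" x]
      le that fin by simp
  have closed: "h x > 0"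
    if h: "\<And>x. x \<in> A \<Longrightarrow> h x \<ge> 0" "\<And>x. x \<in> A \<Longrightarrow> (\<Sum>y\<in>A. K x y * h y) = h x * (\<Sum>y\<in>A. K y x)"
      and "y \<in> A" "h y > 0" "x \<in> A" "K x y > 0" for h :: "'a \<Rightarrow> real" and x y
  proof -
    have "(\<Sum>y\<in>A. K x y * h y) > 0"
      using that nonneg fin by (intro sum_pos2[of A y]) auto
    then have "h x \<noteq> 0" using h(2)[OF \<open>x \<in> A\<close>] by auto
    with h(1)[OF \<open>x \<in> A\<close>] show ?thesis by simp
  qed
  have pos: "(\<Sum>y\<in>A. K x y * (\<bar>d y\<bar> + d y)) = (\<bar>d x\<bar> + d x) * (\<Sum>y\<in>A. K y x)"
    if "x \<in> A" for x using d[OF that] abs[OF that] by (simp add: algebra_simps sum.distrib)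
  have neg: "(\<Sum>y\<in>A. K x y * (\<bar>d y\<bar> - d y)) = (\<bar>d x\<bar> - d x) * (\<Sum>y\<in>A. K y x)"
    if "x \<in> A" for x using d[OF that] abs[OF that] by (simp add: algebra_simps sum_subtractf)
  have ge: "\<bar>d x\<bar> + d x \<ge> 0" "\<bar>d x\<bar> - d x \<ge> 0" for x by linarith+
  have "d x \<noteq> 0" using neq by (simp add: d_def)
  \<comment> \<open>Since \<open>d\<close> sums to zero without vanishing at \<open>x\<close>, both
    signs occur.\<close>
  have ex_pos: "\<exists>y\<in>A. d y > 0"
  proof (rule ccontr)
    assume "\<not> ?thesis"
    then have "\<And>y. y \<in> A \<Longrightarrow> - d y \<ge> 0" by force
    moreover have "(\<Sum>y\<in>A. - d y) = 0" using sum0 by (simp add: sum_negf)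
    ultimately have "- d x = 0" using fin \<open>x \<in> A\<close> by (simp add: sum_nonneg_eq_0_iff)
    with \<open>d x \<noteq> 0\<close> show False by simp
  qed
  have ex_neg: "\<exists>y\<in>A. d y < 0"
  proof (rule ccontr)
    assume "\<not> ?thesis"
    then have "\<And>y. y \<in> A \<Longrightarrow> d y \<ge> 0" by force
    with sum0 have "d x = 0" using fin \<open>x \<in> A\<close> by (simp add: sum_nonneg_eq_0_iff)
    with \<open>d x \<noteq> 0\<close> show False by simp
  qed
  have "{y\<in>A. d y > 0} \<inter> {y\<in>A. d y < 0} \<noteq> {}"
  proof (rule meet)
    fix x y assume "y \<in> {y\<in>A. d y > 0}" "x \<in> A" "K x y > 0"
    with closed[of "\<lambda>y. \<bar>d y\<bar> + d y" y x, OF ge(1) pos] show "x \<in> {y\<in>A. d y > 0}"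
      by (auto simp: abs_if split: if_splits)
  next
    fix x y assume "y \<in> {y\<in>A. d y < 0}" "x \<in> A" "K x y > 0"
    with closed[of "\<lambda>y. \<bar>d y\<bar> - d y" y x, OF ge(2) neg] show "x \<in> {y\<in>A. d y < 0}"
      by (auto simp: abs_if split: if_splits)
  qed (use ex_pos ex_neg in auto)
  then show False by auto
qed

section \<open>Sorting by bells: height and rising sets\<close>

definition height :: "nat \<Rightarrow> site set \<Rightarrow> nat" where
  "height n X = (\<Sum>s\<in>X. pos n s)"

text \<open>The exception is the cut from \<open>L_n\<close> to \<open>U_n\<close>: a rising subset
  of the ring is a final segment of the positions.\<close>

definition rising :: "nat \<Rightarrow> site set \<Rightarrow> bool" where
  "rising n X \<longleftrightarrow> (\<forall>s\<in>X. s \<noteq> (False, n) \<longrightarrow> succ_site n s \<in> X)"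

lemma height_bell_set:
  assumes "X \<subseteq> sites n" "s \<in> sites n" "s \<noteq> (False, n)"
  shows "height n (bell_set n s X) = (if s \<in> X \<and> succ_site n s \<notin> X then Suc (height n X) else height n X)"
proof -
  have "finite X" using assms finite_sites finite_subset by blast
  moreover have "pos n (succ_site n s) = Suc (pos n s)"
    using assms by (cases s rule: site_cases) (auto simp: pos_def)
  ultimately show ?thesis
    by (auto simp: height_def hop_def sum.remove[of X s])
qed

text \<open>Away from the cut, each bell that moves raises the height by one, so no gain in height
  means that neither bell moved. The condition on \<open>snd s\<close> discards
  \<open>(False, 0)\<close>, which is no site.\<close>

lemma height_sigma_set:
  assumes "X \<subseteq> sites n" "1 \<le> n" "j < n"
  shows "height n X \<le> height n (sigma_set n j X)"
    and "height n (sigma_set n j X) \<le> height n X \<Longrightarrow>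
      (s = (True, j + 1) \<or> s = (False, j)) \<and> 1 \<le> snd s \<Longrightarrow> s \<in> X \<Longrightarrow> succ_site n s \<in> X"
proof -
  have *: "height n X \<le> height n (sigma_set n j X) \<and>
    (height n (sigma_set n j X) \<le> height n X \<longrightarrow>
      (\<forall>s. (s = (True, j + 1) \<or> s = (False, j)) \<and> 1 \<le> snd s \<longrightarrow> s \<in> X \<longrightarrow> succ_site n s \<in> X))"
  proof (cases "j = 0")
    case True
    then show ?thesis using height_bell_set[OF assms(1), of "(True, 1)"] assms(2)
      by (auto simp: sigma_set_def simp del: succ_site.simps)
  next
    case False
    define Y where "Y = bell_set n (False, j) X"
    have Y: "Y \<subseteq> sites n" unfolding Y_def
      using False assms by (intro cyclic_pair.hop_subset[OF cyclic_pair_cw_site]) auto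
    have hY: "height n Y = (if (False, j) \<in> X \<and> succ_site n (False, j) \<notin> X then Suc (height n X) else height n X)"
      unfolding Y_def using height_bell_set[OF assms(1), of "(False, j)"] False assms by simp
    have h: "height n (sigma_set n j X) = (if (True, j + 1) \<in> Y \<and> succ_site n (True, j + 1) \<notin> Y
        then Suc (height n Y) else height n Y)"
      using height_bell_set[OF Y, of "(True, j + 1)"] False assms by (simp add: sigma_set_def Y_def)
    show ?thesis
    proof (intro conjI impI allI)
      show "height n X \<le> height n (sigma_set n j X)" unfolding h hY by simp
      fix s assume le: "height n (sigma_set n j X) \<le> height n X"
        and s: "(s = (True, j + 1) \<or> s = (False, j)) \<and> 1 \<le> snd s" "s \<in> X"
      have "\<not> ((False, j) \<in> X \<and> succ_site n (False, j) \<notin> X)"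
        using le unfolding h hY by (auto split: if_splits)
      moreover from this have "Y = X" by (auto simp: Y_def hop_def)
      moreover have "\<not> ((True, j + 1) \<in> Y \<and> succ_site n (True, j + 1) \<notin> Y)"
        using le unfolding h hY by (auto split: if_splits)
      ultimately show "succ_site n s \<in> X" using s by blast
    qed
  qed
  then show "height n X \<le> height n (sigma_set n j X)" by blast
  show "succ_site n s \<in> X" if "height n (sigma_set n j X) \<le> height n X"
      "(s = (True, j + 1) \<or> s = (False, j)) \<and> 1 \<le> snd s" "s \<in> X"
    using * that by blast
qed

lemma rising_mem:
  assumes "rising n X" "X \<subseteq> sites n" "s \<in> X" "s' \<in> sites n" "pos n s \<le> pos n s'"
  shows "s' \<in> X"
proof -
  have "site_at n (pos n s + k) \<in> X" if "pos n s + k < 2 * n" for k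
    using that
  proof (induction k)
    case 0
    then show ?case using assms by (auto simp: site_at_pos)
  next
    case (Suc k)
    then have "site_at n (pos n s + k) \<noteq> (False, n)" by (auto simp: site_at_def)
    with Suc assms(1) have "succ_site n (site_at n (pos n s + k)) \<in> X" by (simp add: rising_def)
    with Suc show ?case by (simp add: succ_site_at)
  qed
  from this[of "pos n s' - pos n s"] show ?thesis using assms pos_less[of s' n] by (simp add: site_at_pos)
qed

text \<open>Final segments of the same enumeration are nested, so their size decides.\<close>

lemma rising_unique:
  assumes "rising n X" "X \<subseteq> sites n" "rising n Y" "Y \<subseteq> sites n" "card X = card Y"
  shows "X = Y"
proof -
  have "X \<subseteq> Y \<or> Y \<subseteq> X"
    using rising_mem[OF assms(1,2)] rising_mem[OF assms(3,4)] assms(2,4) by (meson linear subset_iff)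
  then show ?thesis
    using assms by (metis card_subset_eq finite_sites finite_subset)
qed

lemma below_Omega_ge:
  assumes "x \<in> Omega n J" "n \<le> c"
  shows "below c x = below n x"
proof (rule set_eqI)
  show "s \<in> below c x \<longleftrightarrow> s \<in> below n x" for s
    using class_le_Omega[OF assms(1), of s] assms(2) by (cases "x s") (simp_all add: below_def)
qed

text \<open>Bells other than \<open>\<sigma>\<^sub>n\<close> drive every state to the sorted one, with all particles lined
  up before \<open>L_n\<close>; sortedness is detected by maximality of the total height.\<close>
lemma closed_has_rising:
  assumes n: "1 \<le> n" and B: "B \<subseteq> Omega n J" "B \<noteq> {}"
    and closed: "\<And>x j. x \<in> B \<Longrightarrow> j < n \<Longrightarrow> sigma n j x \<in> B"
  shows "\<exists>x\<in>B. \<forall>c. rising n (below c x)"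
proof -
  \<comment> \<open>Levels up to \<open>n\<close> suffice, because classes in
    \<open>Omega n J\<close> never exceed \<open>n\<close>.\<close>
  define H where "H x = (\<Sum>c\<le>n. height n (below c x))" for x
  have fin: "finite (H ` B)" using B(1) finite_Omega by (intro finite_imageI) (rule finite_subset)
  have "Max (H ` B) \<in> H ` B" using fin B(2) by (intro Max_in) auto
  then obtain x where "x \<in> B" "H x = Max (H ` B)" by auto
  then have x: "x \<in> B" "\<And>y. y \<in> B \<Longrightarrow> H y \<le> H x" using fin by auto
  have xO: "x \<in> Omega n J" using x(1) B(1) by (rule rev_subsetD)
  have sub: "below c x \<subseteq> sites n" for c by (rule below_sites[OF Omega_wf[OF xO]])
  have le: "rising n (below c x)" if "c \<le> n" for c
    unfolding rising_def
  proof (intro ballI impI)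
    fix s assume s: "s \<in> below c x" "s \<noteq> (False, n)"
    then have "s \<in> sites n" using subsetD[OF sub] by simp
    \<comment> \<open>Every site other than \<open>L_n\<close> is rung by some
      \<open>sigma n j\<close> with \<open>j < n\<close>.\<close>
    with s(2) obtain j where j: "j < n" "(s = (True, j + 1) \<or> s = (False, j)) \<and> 1 \<le> snd s"
    proof (cases s rule: site_cases)
      case (1 k)
      with \<open>s \<in> sites n\<close> show ?thesis by (intro that[of "k - 1"]) auto
    next
      case (2 k)
      with \<open>s \<in> sites n\<close> s(2) show ?thesis by (intro that[of k]) auto
    qed
    have mono: "height n (below c x) \<le> height n (below c (sigma n j x))" for c
      using height_sigma_set(1)[OF sub n j(1)] n j(1) by (simp add: below_sigma)
    \<comment> \<open>No level loses height and the total is maximal, so every level keeps its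
      height.\<close>
    have "H (sigma n j x) \<le> H x" using x closed j(1) by blast
    then have "H (sigma n j x) = H x" unfolding H_def
      by (rule antisym) (rule sum_mono[OF mono])
    then have "height n (below c (sigma n j x)) = height n (below c x)"
      using sum_mono_inv[of "\<lambda>c. height n (below c x)" "{..n}" "\<lambda>c. height n (below c (sigma n j x))" c]
        mono that unfolding H_def by simp
    then show "succ_site n s \<in> below c x"
      using height_sigma_set(2)[OF sub n j(1) _ j(2) s(1)] n j(1) by (simp add: below_sigma)
  qed
  have "rising n (below c x)" for c
    using le[of c] le[of n] below_Omega_ge[OF xO, of c] by (cases "c \<le> n") auto
  with x(1) show ?thesis by blast
qed

section \<open>Uniqueness, existence and transport of the stationary distribution\<close>

lemma Mmat_pos:
  assumes "x \<in> Omega n J" "1 \<le> n" "j \<le> n"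
  shows "Mmat n J (sigma n j x) x > 0"
proof -
  have "rate n j \<le> (\<Sum>i\<in>{0..n}. if sigma n i x = sigma n j x then rate n i else 0)"
    using assms(3) member_le_sum[of j "{0..n}" "\<lambda>i. if sigma n i x = sigma n j x then rate n i else 0"]
    by simp
  moreover have "rate n j > 0" by (simp add: rate_def)
  ultimately show ?thesis using assms sigma_Omega[OF assms] by (simp add: Mmat_def)
qed

text \<open>Every nonempty closed set contains a state whose truncations are all rising. The type
  fixes their sizes, so there is only one such state, and any two closed sets meet.\<close>

lemma is_stationary_unique:
  assumes n: "1 \<le> n" and p: "is_stationary n J p" and q: "is_stationary n J q"
  shows "p = q"
proof
  fix x
  show "p x = q x"
  proof (cases "x \<in> Omega n J")
    case True
    let ?K = "\<lambda>x y. real (Mmat n J x y)"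
    show ?thesis
    proof (rule stationary_unique[where K = ?K, OF finite_Omega _ _ _ _ _ True])
      fix B C
      assume B: "B \<subseteq> Omega n J" "B \<noteq> {}" and C: "C \<subseteq> Omega n J" "C \<noteq> {}"
        and clB: "\<And>x y. y \<in> B \<Longrightarrow> x \<in> Omega n J \<Longrightarrow> ?K x y > 0 \<Longrightarrow> x \<in> B"
        and clC: "\<And>x y. y \<in> C \<Longrightarrow> x \<in> Omega n J \<Longrightarrow> ?K x y > 0 \<Longrightarrow> x \<in> C"
      have "sigma n j z \<in> B" if "z \<in> B" "j < n" for z j
      proof (rule clB[OF that(1)])
        have "z \<in> Omega n J" using that(1) B(1) by (rule rev_subsetD)
        then show "sigma n j z \<in> Omega n J" "?K (sigma n j z) z > 0"
          using that(2) n by (simp_all add: sigma_Omega Mmat_pos)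
      qed
      from closed_has_rising[OF n B this]
      obtain x where x: "x \<in> B" "\<And>c. rising n (below c x)" by auto
      have "sigma n j z \<in> C" if "z \<in> C" "j < n" for z j
      proof (rule clC[OF that(1)])
        have "z \<in> Omega n J" using that(1) C(1) by (rule rev_subsetD)
        then show "sigma n j z \<in> Omega n J" "?K (sigma n j z) z > 0"
          using that(2) n by (simp_all add: sigma_Omega Mmat_pos)
      qed
      from closed_has_rising[OF n C this]
      obtain y where y: "y \<in> C" "\<And>c. rising n (below c y)" by auto
      have xy: "x \<in> Omega n J" "y \<in> Omega n J" using x(1) y(1) B(1) C(1) by (simp_all add: subset_iff)
      have "card (below c x) = card (below c y)" for c using xy by (simp add: Omega_iff)
      then have "below c x = below c y" for c
        using x(2) y(2) xy by (intro rising_unique[of n] below_sites Omega_wf)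
      then have "x = y" by (rule state_eqI)
      with x y show "B \<inter> C \<noteq> {}" by blast
    qed (use p q in \<open>simp_all add: is_stationary_def\<close>)
  next
    case False
    with p q show ?thesis by (simp add: is_stationary_def)
  qed
qed

lemma is_stationary_exists: "\<exists>p. is_stationary n J p"
proof -
  let ?K = "\<lambda>x y. real (Mmat n J x y)" and ?A = "Omega n J"
  obtain p where p: "\<And>x. x \<in> ?A \<Longrightarrow> p x \<ge> 0" "\<exists>x\<in>?A. p x > 0"
      "\<And>x. x \<in> ?A \<Longrightarrow> (\<Sum>y\<in>?A. ?K x y * p y) = p x * (\<Sum>y\<in>?A. ?K y x)"
    using stationary_exists[OF finite_Omega[of n J] Omega_nonempty, where K = ?K] by auto
  define Z where "Z = sum p ?A"
  have Z: "Z > 0" unfolding Z_def using p(1,2) finite_Omega by (auto intro: sum_pos2)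
  have "(\<Sum>y\<in>?A. ?K x y * (p y / Z)) = p x / Z * (\<Sum>y\<in>?A. ?K y x)" if "x \<in> ?A" for x
    using p(3)[OF that] by (simp add: sum_divide_distrib[symmetric])
  moreover have "(\<Sum>y\<in>?A. p y / Z) = 1" using Z by (simp add: sum_divide_distrib[symmetric] Z_def[symmetric])
  ultimately have "is_stationary n J (\<lambda>x. if x \<in> ?A then p x / Z else 0)"
    using p(1) Z by (simp add: is_stationary_def cong: sum.cong)
  then show ?thesis by blast
qed

lemma is_stationary_pi_stat: "1 \<le> n \<Longrightarrow> is_stationary n J (pi_stat n J)"
  unfolding pi_stat_def using is_stationary_exists is_stationary_unique by (metis theI)

text \<open>Self-loops are counted, so every state has the same total rate, and stationarity becomes
  an eigenvector equation.\<close>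

lemma sum_Mmat_col:
  assumes "x \<in> Omega n J" "1 \<le> n"
  shows "(\<Sum>y\<in>Omega n J. real (Mmat n J y x)) = (\<Sum>j\<in>{0..n}. real (rate n j))"
  using sum_Mmat[OF assms, of "\<lambda>_. 1 :: real"] by simp

text \<open>Applying \<open>M_J\<close> to \<open>U p\<close> gives \<open>U M_{J'} p\<close> by
  intertwining, a multiple of \<open>U p\<close>. As the columns of \<open>U\<close> sum to
  \<open>2 ^ n\<close>, the normalised vector is a distribution, and uniqueness identifies
  it.\<close>

lemma pi_stat_tau:
  assumes n: "n \<ge> 2" "n \<notin> J" and v: "v \<in> Omega n J"
  shows "(\<Sum>u\<in>Omega n (insert n J). pi_stat n (insert n J) u * (real (Umat n v u) / 2 ^ n)) = pi_stat n J v"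
proof -
  let ?A = "Omega n J" and ?A' = "Omega n (insert n J)"
  define p where "p = pi_stat n (insert n J)"
  define R where "R = (\<Sum>j\<in>{0..n}. real (rate n j))"
  define q where "q v = (if v \<in> ?A then \<Sum>u\<in>?A'. p u * (real (Umat n v u) / 2 ^ n) else 0)" for v
  have p: "is_stationary n (insert n J) p" unfolding p_def by (rule is_stationary_pi_stat) (use n in simp)
  have pM: "(\<Sum>u\<in>?A'. real (Mmat n (insert n J) w u) * p u) = R * p w" if "w \<in> ?A'" for w
    using p that n sum_Mmat_col[OF that] by (simp add: is_stationary_def R_def mult.commute)
  have "(\<Sum>v\<in>?A. q v) = (\<Sum>u\<in>?A'. \<Sum>v\<in>?A. p u * (real (Umat n v u) / 2 ^ n))"
    unfolding q_def by (simp add: sum.swap[of _ ?A ?A'] cong: sum.cong)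
  also have "\<dots> = (\<Sum>u\<in>?A'. p u)"
  proof (intro sum.cong refl)
    fix u assume u: "u \<in> ?A'"
    have "(\<Sum>v\<in>?A. p u * (real (Umat n v u) / 2 ^ n)) = p u / 2 ^ n * (\<Sum>v\<in>?A. real (Umat n v u))"
      by (simp add: sum_distrib_left)
    also have "(\<Sum>v\<in>?A. real (Umat n v u)) = 2 ^ n"
      using sum_Umat[OF u n(2), of "\<lambda>_. 1 :: real"] by (simp add: card_signs)
    finally show "(\<Sum>v\<in>?A. p u * (real (Umat n v u) / 2 ^ n)) = p u" by simp
  qed
  also have "\<dots> = 1" using p by (simp add: is_stationary_def)
  finally have total: "(\<Sum>v\<in>?A. q v) = 1" .
  have stat: "(\<Sum>w\<in>?A. real (Mmat n J v w) * q w) = R * q v" if v: "v \<in> ?A" for v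
  proof -
    have "(\<Sum>w\<in>?A. real (Mmat n J v w) * q w)
        = (\<Sum>w\<in>?A. \<Sum>u\<in>?A'. p u / 2 ^ n * (real (Mmat n J v w) * real (Umat n w u)))"
      by (simp add: q_def sum_distrib_left algebra_simps)
    also have "\<dots> = (\<Sum>u\<in>?A'. \<Sum>w\<in>?A. p u / 2 ^ n * (real (Mmat n J v w) * real (Umat n w u)))"
      by (rule sum.swap)
    also have "\<dots> = (\<Sum>u\<in>?A'. \<Sum>w\<in>?A'. p u / 2 ^ n * (real (Umat n v w) * real (Mmat n (insert n J) w u)))"
    proof (rule sum.cong[OF refl])
      fix u assume u: "u \<in> ?A'"
      show "(\<Sum>w\<in>?A. p u / 2 ^ n * (real (Mmat n J v w) * real (Umat n w u)))
          = (\<Sum>w\<in>?A'. p u / 2 ^ n * (real (Umat n v w) * real (Mmat n (insert n J) w u)))"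
        using arg_cong[OF Umat_intertwines[OF n v u], of real]
        unfolding sum_distrib_left[symmetric] by (simp only: of_nat_sum of_nat_mult)
    qed
    also have "\<dots> = (\<Sum>w\<in>?A'. \<Sum>u\<in>?A'. p u / 2 ^ n * (real (Umat n v w) * real (Mmat n (insert n J) w u)))"
      by (rule sum.swap)
    also have "\<dots> = (\<Sum>w\<in>?A'. real (Umat n v w) / 2 ^ n * (\<Sum>u\<in>?A'. real (Mmat n (insert n J) w u) * p u))"
      by (simp add: sum_distrib_left algebra_simps)
    also have "\<dots> = (\<Sum>w\<in>?A'. real (Umat n v w) / 2 ^ n * (R * p w))"
      by (intro sum.cong refl) (simp add: pM)
    also have "\<dots> = R * q v"
      using v by (simp add: q_def sum_distrib_left algebra_simps)
    finally show ?thesis .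
  qed
  have "is_stationary n J q"
    unfolding is_stationary_def
  proof (intro conjI allI impI ballI)
    fix x assume x: "x \<in> ?A"
    show "q x \<ge> 0" using p by (auto simp: q_def is_stationary_def intro!: sum_nonneg)
    show "(\<Sum>y\<in>?A. real (Mmat n J x y) * q y) = q x * (\<Sum>y\<in>?A. real (Mmat n J y x))"
      using stat[OF x] sum_Mmat_col[OF x] n by (simp add: R_def mult.commute)
  qed (use total in \<open>auto simp: q_def\<close>)
  then have "q = pi_stat n J"
    using is_stationary_unique is_stationary_pi_stat n by (metis One_nat_def Suc_1 Suc_leD)
  then show ?thesis using v by (simp add: q_def p_def fun_eq_iff split: if_splits)
qed

theorem theorem1:
  fixes n :: nat and J J' :: "nat set"
  assumes "n \<ge> 2" and "J \<subseteq> {1..n-1}" and "J' = insert n J"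
  shows "(\<forall>v\<in>Omega n J. \<forall>u\<in>Omega n J'.
            (\<Sum>w\<in>Omega n J'. Umat n v w * Mmat n J' w u)
          = (\<Sum>w\<in>Omega n J. Mmat n J v w * Umat n w u))
       \<and> (\<forall>v\<in>Omega n J.
            (\<Sum>u\<in>Omega n J'. pi_stat n J' u * (real (Umat n v u) / 2 ^ n))
          = pi_stat n J v)"
proof -
  have "n \<notin> J" using assms by auto
  then show ?thesis unfolding assms(3) using Umat_intertwines[OF assms(1)] pi_stat_tau[OF assms(1)] by blast
qed

end
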